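(* Let $U\subset D(A^\infty)$ be an open set on which the distribution $D_{LA}$ has constant dimension $k_D$, and suppose $k_D=d+1$. Then there exist $d$ linearly independent (constant) vectors $\Lambda_1,\dots,\Lambda_d\in D(A^\infty)$ such that $$\sigma^j(h)\in\langle\Lambda_1,\dots,\Lambda_d\rangle\quad\text{for all }h\in U,\ j=1,\dots,d.$$
   Context: Smoothness: a curve into a Fréchet space is smooth if all derivatives exist as limits of difference quotients; a map between open subsets of Fréchet spaces is smooth if it maps smooth curves to smooth curves. The Lie bracket of vector fields (smooth maps $U\to E$, $U$ open in a Fréchet space $E$) is $[X,Y](x)=DX(x)\cdot Y(x)-DY(x)\cdot X(x)$. $\langle\dots\rangle$ denotes real linear span. Setting: $H$ is a separable Hilbert space of continuous functions $\mathbb{R}_{\ge0}\to\mathbb{R}$ such that: the point evaluations $ev_x:h\mapsto h(x)$ are continuous on $H$; the shifts $S(t)f(x)=f(t+x)$, $t\ge 0$, form a strongly continuous semigroup on $H$, with generator $A$, where $D(A)=\{h\in H\cap C^1(\mathbb{R}_{\ge0};\mathbb{R}) : h'\in H\}$ and $Ah=h'$; there is a closed subspace $H_0\subset H$ such that $\mathcal{S}(f,g)(x):=f(x)\int_0^x g(\eta)\,d\eta$ defines a continuous bilinear map $\mathcal{S}:H_0\times H_0\to H$. Write $\mathcal{S}(f)=\mathcal{S}(f,f)$. $D(A^\infty)=\bigcap_n D(A^n)$ is the Fréchet space with seminorms $p_n(h)=\sum_{m=0}^n\|A^mh\|_H$, $n\ge0$. $A_0$ is the restriction of $A$ to $H_0$,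 $D(A_0)=\{h\in D(A)\cap H_0: Ah\in H_0\}$, and $D(A_0^\infty)=\bigcap_n D(A_0^n)$ is the analogous Fréchet space. Let $d\in\mathbb{N}$, $d\ge1$, $B$ a Banach space, $\ell:H\to B$ continuous linear, $\phi=(\phi^1,\dots,\phi^d):B\to D(A_0^\infty)^d$ smooth, and assume: $(\ell,\ell\circ A):D(A^\infty)\to B\times B$ is an open map; $\phi^1(y),\dots,\phi^d(y)$ are linearly independent for each $y\in B$; $A$ is unbounded, i.e. $D(A)\ne H$. Put $\sigma^j(h)=\phi^j(\ell(h))$ and $$\mu(h)=Ah+\sum_{j=1}^d\mathcal{S}(\sigma^j(h))-\tfrac12\sum_{j=1}^dD\sigma^j(h)\sigma^j(h),\qquad h\in D(A^\infty).$$ These are smooth vector fields on $D(A^\infty)$. $D_{LA}$ is the distribution on $D(A^\infty)$ whose value $D_{LA}(h)$ is the linear span of the values at $h$ of $\mu,\sigma^1,\dots,\sigma^d$ and all their iterated (multiple) Lie brackets.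
   Formalization: The open set U is additionally assumed connected; for disconnected U the claim fails, since σ may take values in different fixed d-dimensional spaces on different components of U. *)

theory Defs
  imports "HOL-Analysis.Analysis"
begin

text \<open>
  A Frechet space is represented by a topology \<open>X\<close> on a real vector space whose carrier
  \<open>topspace X\<close> is a linear subspace; a Banach space is the special case \<open>euclidean\<close>.
  The topology below is the one defined by the seminorms \<open>p n\<close> on the subspace \<open>E\<close>;
  the open seminorm balls in \<open>E\<close> form a subbasis of it.
\<close>

definition seminorm_topology :: "'a::real_vector set \<Rightarrow> (nat \<Rightarrow> 'a \<Rightarrow> real) \<Rightarrow> 'a topology" where
  "seminorm_topology E p =
     topology_generated_by {{g \<in> E. p n (g - h) < r} | n h r. h \<in> E}"

lemma topspace_seminorm_topology [simp]: "topspace (seminorm_topology E p) = E"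
proof -
  have "\<Union>{{g \<in> E. p n (g - h) < r} | n h r. h \<in> E} = E"
  proof (intro equalityI subsetI)
    fix x assume "x \<in> E"
    then have "x \<in> {g \<in> E. p 0 (g - x) < p 0 (x - x) + 1}" by simp
    with \<open>x \<in> E\<close> show "x \<in> \<Union>{{g \<in> E. p n (g - h) < r} | n h r. h \<in> E}" by blast
  qed blast
  then show ?thesis by (simp add: seminorm_topology_def)
qed

definition smooth_curve :: "'a::real_vector topology \<Rightarrow> (real \<Rightarrow> 'a) \<Rightarrow> bool" where
  "smooth_curve X c \<longleftrightarrow>
     (\<exists>D :: nat \<Rightarrow> real \<Rightarrow> 'a. D 0 = c \<and>
        (\<forall>n t. D n t \<in> topspace X \<and>
               limitin X (\<lambda>s. (D n (t + s) - D n t) /\<^sub>R s) (D (Suc n) t) (at 0)))"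

definition smooth_map ::
    "'a::real_vector topology \<Rightarrow> 'b::real_vector topology \<Rightarrow> ('a \<Rightarrow> 'b) \<Rightarrow> bool" where
  "smooth_map X Y f \<longleftrightarrow> (\<forall>c. smooth_curve X c \<longrightarrow> smooth_curve Y (f \<circ> c))"

text \<open>
  The derivative \<open>DF(x) \<cdot> v\<close> of \<open>F : X \<rightarrow> X\<close>. The definite description denotes the limit
  whenever it exists, provided \<open>X\<close> is Hausdorff.
\<close>

definition dir_deriv :: "'a::real_vector topology \<Rightarrow> ('a \<Rightarrow> 'a) \<Rightarrow> 'a \<Rightarrow> 'a \<Rightarrow> 'a" where
  "dir_deriv X F x v = (THE w. limitin X (\<lambda>s. (F (x + s *\<^sub>R v) - F x) /\<^sub>R s) w (at 0))"

definition lie_bracket ::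
    "'a::real_vector topology \<Rightarrow> ('a \<Rightarrow> 'a) \<Rightarrow> ('a \<Rightarrow> 'a) \<Rightarrow> 'a \<Rightarrow> 'a" where
  "lie_bracket X F G = (\<lambda>x. dir_deriv X F x (G x) - dir_deriv X G x (F x))"

inductive_set iterated_brackets ::
    "'a::real_vector topology \<Rightarrow> ('a \<Rightarrow> 'a) set \<Rightarrow> ('a \<Rightarrow> 'a) set"
  for X :: "'a topology" and V :: "('a \<Rightarrow> 'a) set" where
  base: "F \<in> V \<Longrightarrow> F \<in> iterated_brackets X V"
| bracket: "F \<in> iterated_brackets X V \<Longrightarrow> G \<in> iterated_brackets X V \<Longrightarrow>
    lie_bracket X F G \<in> iterated_brackets X V"

definition lie_distribution ::
    "'a::real_vector topology \<Rightarrow> ('a \<Rightarrow> 'a) set \<Rightarrow> 'a \<Rightarrow> 'a set" where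
  "lie_distribution X V h = span ((\<lambda>F. F h) ` iterated_brackets X V)"

text \<open>Injectivity is needed because \<open>independent\<close> of the image set ignores repetitions.\<close>

definition independent_family :: "('i \<Rightarrow> 'a::real_vector) \<Rightarrow> 'i set \<Rightarrow> bool" where
  "independent_family v I \<longleftrightarrow> inj_on v I \<and> independent (v ` I)"

definition strongly_continuous_semigroup :: "(real \<Rightarrow> 'a::real_normed_vector \<Rightarrow> 'a) \<Rightarrow> bool" where
  "strongly_continuous_semigroup T \<longleftrightarrow>
     (\<forall>t\<ge>0. bounded_linear (T t)) \<and>
     (\<forall>h. T 0 h = h) \<and>
     (\<forall>s\<ge>0. \<forall>t\<ge>0. \<forall>h. T (s + t) h = T s (T t h)) \<and>
     (\<forall>h. ((\<lambda>t. T t h) \<longlongrightarrow> h) (at_right 0))"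

definition generator_dom :: "(real \<Rightarrow> 'a::real_normed_vector \<Rightarrow> 'a) \<Rightarrow> 'a set" where
  "generator_dom T = {h. \<exists>g. ((\<lambda>t. (T t h - h) /\<^sub>R t) \<longlongrightarrow> g) (at_right 0)}"

definition generator :: "(real \<Rightarrow> 'a::real_normed_vector \<Rightarrow> 'a) \<Rightarrow> 'a \<Rightarrow> 'a" where
  "generator T h = Lim (at_right 0) (\<lambda>t. (T t h - h) /\<^sub>R t)"

text \<open>
  \<open>power_dom V D A n\<close> is the domain of the \<open>n\<close>-th power of the operator \<open>A\<close> with domain \<open>D\<close>
  in the space \<open>V\<close>.
\<close>

primrec power_dom :: "'a set \<Rightarrow> 'a set \<Rightarrow> ('a \<Rightarrow> 'a) \<Rightarrow> nat \<Rightarrow> 'a set" where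
  "power_dom V D A 0 = V"
| "power_dom V D A (Suc n) = {h \<in> D. A h \<in> power_dom V D A n}"

definition graph_seminorm :: "('a::real_normed_vector \<Rightarrow> 'a) \<Rightarrow> nat \<Rightarrow> 'a \<Rightarrow> real" where
  "graph_seminorm A n h = (\<Sum>m\<le>n. norm ((A ^^ m) h))"

definition smooth_domain ::
    "'a::real_normed_vector set \<Rightarrow> 'a set \<Rightarrow> ('a \<Rightarrow> 'a) \<Rightarrow> 'a topology" where
  "smooth_domain V D A = seminorm_topology (\<Inter>n. power_dom V D A n) (graph_seminorm A)"

definition DAinf :: "(real \<Rightarrow> 'a::real_normed_vector \<Rightarrow> 'a) \<Rightarrow> 'a topology" where
  "DAinf T = smooth_domain UNIV (generator_dom T) (generator T)"

definition DA0inf :: "(real \<Rightarrow> 'a::real_normed_vector \<Rightarrow> 'a) \<Rightarrow> 'a set \<Rightarrow> 'a topology" where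
  "DA0inf T H0 =
     smooth_domain H0 {h \<in> generator_dom T \<inter> H0. generator T h \<in> H0} (generator T)"

text \<open>
  The Hilbert space of functions is a type \<open>'h\<close> together with the map \<open>ev\<close> that sends an
  element to the function it is; only the values \<open>ev h x\<close> with \<open>x \<ge> 0\<close> are meaningful.
  \<open>T\<close> is the shift semigroup and \<open>S f g\<close> (for \<open>f, g \<in> H0\<close>) the element of the Hilbert space with
  \<open>S f g (x) = f(x) \<integral>\<^bsub>0\<^esub>\<^bsup>x\<^esup> g\<close>. Both are determined by \<open>shift\<close>, \<open>S_eval\<close> and \<open>ev_inj\<close>, and
  \<open>S\<close> is automatically bilinear on \<open>H0\<close>. In \<open>generator_dom_eq\<close> the function \<open>ev h\<close> is
  automatically continuously differentiable, since its derivative \<open>ev g\<close> is continuous.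
\<close>

locale forward_curve_space =
  fixes ev :: "'h::{real_inner, complete_space} \<Rightarrow> real \<Rightarrow> real"
    and T :: "real \<Rightarrow> 'h \<Rightarrow> 'h"
    and H0 :: "'h set"
    and S :: "'h \<Rightarrow> 'h \<Rightarrow> 'h"
  assumes separable: "separable_space (euclidean :: 'h topology)"
    and ev_inj: "(\<And>x. x \<ge> 0 \<Longrightarrow> ev f x = ev g x) \<Longrightarrow> f = g"
    and ev_continuous: "continuous_on {0..} (ev h)"
    and ev_bounded_linear: "x \<ge> 0 \<Longrightarrow> bounded_linear (\<lambda>h. ev h x)"
    and shift: "t \<ge> 0 \<Longrightarrow> x \<ge> 0 \<Longrightarrow> ev (T t h) x = ev h (t + x)"
    and semigroup: "strongly_continuous_semigroup T"
    and generator_dom_eq: "generator_dom T =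
      {h. \<exists>g. \<forall>x\<ge>0. (ev h has_real_derivative ev g x) (at x within {0..})}"
    and generator_eq: "h \<in> generator_dom T \<Longrightarrow> x \<ge> 0 \<Longrightarrow>
      (ev h has_real_derivative ev (generator T h) x) (at x within {0..})"
    and H0_subspace: "subspace H0"
    and H0_closed: "closed H0"
    and S_eval: "f \<in> H0 \<Longrightarrow> g \<in> H0 \<Longrightarrow> x \<ge> 0 \<Longrightarrow>
      ev (S f g) x = ev f x * integral {0..x} (ev g)"
    and S_continuous: "continuous_on (H0 \<times> H0) (\<lambda>(f, g). S f g)"

definition vol :: "(nat \<Rightarrow> 'b \<Rightarrow> 'h) \<Rightarrow> ('h \<Rightarrow> 'b) \<Rightarrow> nat \<Rightarrow> 'h \<Rightarrow> 'h" where
  "vol \<phi> l j h = \<phi> j (l h)"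

definition drift ::
    "(real \<Rightarrow> 'h::real_normed_vector \<Rightarrow> 'h) \<Rightarrow> ('h \<Rightarrow> 'h \<Rightarrow> 'h) \<Rightarrow> nat \<Rightarrow>
     (nat \<Rightarrow> 'h \<Rightarrow> 'h) \<Rightarrow> 'h \<Rightarrow> 'h" where
  "drift T S d \<sigma> h = generator T h + (\<Sum>j=1..d. S (\<sigma> j h) (\<sigma> j h))
     - (1/2) *\<^sub>R (\<Sum>j=1..d. dir_deriv (DAinf T) (\<sigma> j) h (\<sigma> j h))"

text \<open>
  Note that \<open>dim\<close> is \<open>0\<close> on infinite-dimensional subspaces, so a positive value of
  \<open>dim (D_LA T S d \<sigma> h)\<close> is the true dimension.
\<close>

definition D_LA ::
    "(real \<Rightarrow> 'h::real_normed_vector \<Rightarrow> 'h) \<Rightarrow> ('h \<Rightarrow> 'h \<Rightarrow> 'h) \<Rightarrow> nat \<Rightarrow>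
     (nat \<Rightarrow> 'h \<Rightarrow> 'h) \<Rightarrow> 'h \<Rightarrow> 'h set" where
  "D_LA T S d \<sigma> = lie_distribution (DAinf T) (insert (drift T S d \<sigma>) (\<sigma> ` {1..d}))"

end

theory Submission
  imports Defs "HOL-Computational_Algebra.Polynomial"
begin

text \<open>
  Write \<open>y = l h\<close> and \<open>z = l (A h)\<close>. The bracket \<open>[\<mu>, \<sigma>\<^sup>i](h)\<close> depends on \<open>(y, z)\<close> only, and on \<open>z\<close> only through
  \<open>- D\<phi>\<^sup>i(y) \<cdot> z\<close>. If it were not in the span of the \<open>\<phi>\<^sup>j(y)\<close>, then together with them it would span the
  distribution at all points \<open>h + t k\<close> with \<open>l k = 0\<close> and \<open>l (A k) = 0\<close>, which also contains \<open>\<mu>(h + t k)\<close>. Then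
  all vectors \<open>A k\<close> would lie in a finite-dimensional space, and this is impossible for unbounded \<open>A\<close>.
  Varying \<open>z\<close>, which is possible since \<open>(l, l \<circ> A)\<close> is open, one gets \<open>D\<phi>\<^sup>i(y) \<cdot> v\<close> in the span of the \<open>\<phi>\<^sup>j(y)\<close>
  for every \<open>v\<close>. Along segments this is a linear differential equation for the frame \<open>\<phi>(y)\<close>, so the
  span is locally constant, and constant because \<open>U\<close> is connected.

  Additivity of \<open>D\<phi>\<^sup>i(y)\<close> is not part of the notion of smoothness along curves. It follows from smoothness
  along one flat oscillating curve.
\<close>

subsection \<open>Finite-dimensional subspaces and moving frames\<close>

text \<open>Smoothness is known only along curves and \<open>dir_deriv\<close> is a definite
  description, so its value is available only where a limit has been exhibited. Accordingly the
  derivative of the drift is never evaluated: brackets with \<open>\<mu>\<close> are compared at two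
  points with equal y, where this term is the same and cancels. What remains are derivatives of the
  frame along lines in the Banach space. The number d + 1 enters as d frame vectors plus one bracket
  outside their span: together they exhaust the distribution and leave no room for the directions A
  k. Unboundedness of A means D(A) differs from H, while the argument needs infinitely many
  dimensions in the image under A of a kernel inside D(A^infinity). The bridge consists of local
  boundedness of the semigroup (by Baire category), density of D(A^infinity) and closedness of A,
  the latter two by averaging orbits and calculus with the real functions \<open>ev h\<close>. The
  vectors finally produced are the frame at one fixed y.\<close>

text \<open>In an orthogonal spanning set the coefficient of c is \<open>inner x c\<close> divided
  by the squared norm of c, and Cauchy-Schwarz bounds it. Linearity is assumed on V alone because
  the lemma is applied to the generator, which is linear only on its domain.\<close>

lemma bounded_on_finite_dimensional:
  fixes f :: "'a::real_inner \<Rightarrow> 'c::real_normed_vector"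
  assumes V: "subspace V" "V \<subseteq> span W" "finite W"
    and add: "\<And>x y. x \<in> V \<Longrightarrow> y \<in> V \<Longrightarrow> f (x + y) = f x + f y"
    and scale: "\<And>a x. x \<in> V \<Longrightarrow> f (a *\<^sub>R x) = a *\<^sub>R f x"
  obtains C where "C \<ge> 0" "\<And>x. x \<in> V \<Longrightarrow> norm (f x) \<le> C * norm x"
proof -
  obtain B where B: "B \<subseteq> V" "independent B" "V \<subseteq> span B"
    using maximal_independent_subset by blast
  have "finite B" using independent_span_bound[OF V(3) B(2)] B(1) V(2) by auto
  then obtain C where C: "finite C" "span C = span B" "pairwise orthogonal C"
    using basis_orthogonal by blast
  have sB: "span B = V" using B V(1) by (metis span_minimal subset_antisym)
  have CV: "C \<subseteq> V" using C(2) sB span_superset by blast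
  have lincomb: "f (\<Sum>c\<in>D. a c *\<^sub>R c) = (\<Sum>c\<in>D. a c *\<^sub>R f c)" if "finite D" "D \<subseteq> V" for D a
    using that
  proof (induction D rule: finite_induct)
    case empty
    then show ?case using scale[of 0 0] subspace_0[OF V(1)] by simp
  next
    case (insert x D)
    then have "(\<Sum>c\<in>D. a c *\<^sub>R c) \<in> V" "a x *\<^sub>R x \<in> V"
      using V(1) by (auto intro!: subspace_sum subspace_mul)
    with insert add scale show ?case by simp
  qed
  define K where "K = (\<Sum>c\<in>C. norm (f c) / norm c)"
  have "norm (f x) \<le> K * norm x" if x: "x \<in> V" for x
  proof -
    have "x \<in> span C" using x sB C by simp
    then obtain a where a: "x = (\<Sum>c\<in>C. a c *\<^sub>R c)"
      using span_finite[OF C(1)] by auto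
    have "norm (a c *\<^sub>R f c) \<le> norm (f c) / norm c * norm x" if c: "c \<in> C" for c
    proof (cases "c = 0")
      case True
      then show ?thesis using scale[of 0 0] subspace_0[OF V(1)] by simp
    next
      case False
      have "inner x c = (\<Sum>b\<in>C. a b * inner b c)" by (simp add: a inner_sum_left)
      also have "\<dots> = (\<Sum>b\<in>C. if b = c then a c * inner c c else 0)"
        using C(3) c by (intro sum.cong) (auto simp: pairwise_def orthogonal_def)
      also have "\<dots> = a c * inner c c" using c C(1) by simp
      finally have "\<bar>a c\<bar> * norm c ^ 2 \<le> norm x * norm c"
        using Cauchy_Schwarz_ineq2[of x c] by (simp add: abs_mult power2_norm_eq_inner)
      then have "\<bar>a c\<bar> \<le> norm x / norm c"
        using False by (simp add: field_simps power2_eq_square)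
      from mult_right_mono[OF this norm_ge_zero[of "f c"]] show ?thesis
        by (simp add: mult_ac)
    qed
    then have "(\<Sum>c\<in>C. norm (a c *\<^sub>R f c)) \<le> K * norm x"
      unfolding K_def sum_distrib_right by (rule sum_mono)
    moreover have "norm (f x) \<le> (\<Sum>c\<in>C. norm (a c *\<^sub>R f c))"
      unfolding a lincomb[OF C(1) CV] by (rule norm_sum)
    ultimately show ?thesis by linarith
  qed
  moreover have "K \<ge> 0" unfolding K_def by (intro sum_nonneg) simp
  ultimately show thesis using that by blast
qed

text \<open>Each coordinate functional is linear on a finite-dimensional span, hence bounded; the
  constants are added. This quantitative form of independence survives small perturbations of the
  family.\<close>

lemma independent_family_coercive:
  fixes v :: "'i \<Rightarrow> 'a::real_inner"
  assumes "independent_family v I" "finite I"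
  obtains \<kappa> where "\<kappa> > 0" "\<And>a. \<kappa> * (\<Sum>i\<in>I. \<bar>a i\<bar>) \<le> norm (\<Sum>i\<in>I. a i *\<^sub>R v i)"
proof -
  have inj: "inj_on v I" and ind: "independent (v ` I)"
    using assms by (auto simp: independent_family_def)
  have "\<exists>C\<ge>0. \<forall>a. \<bar>a i\<bar> \<le> C * norm (\<Sum>j\<in>I. a j *\<^sub>R v j)" if i: "i \<in> I" for i
  proof -
    obtain g :: "'a \<Rightarrow> real" where g: "linear g" "\<And>x. x \<in> v ` I \<Longrightarrow> g x = (if x = v i then 1 else 0)"
      using linear_independent_extend[OF ind, of "\<lambda>x. if x = v i then 1 else 0"] by blast
    obtain C where C: "C \<ge> 0" "\<And>x. x \<in> span (v ` I) \<Longrightarrow> norm (g x) \<le> C * norm x"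
      using bounded_on_finite_dimensional[of "span (v ` I)" "v ` I" g] assms(2) g(1)
      by (auto simp: linear_add linear_scale)
    have "\<bar>a i\<bar> \<le> C * norm (\<Sum>j\<in>I. a j *\<^sub>R v j)" for a
    proof -
      have "g (\<Sum>j\<in>I. a j *\<^sub>R v j) = (\<Sum>j\<in>I. a j * (if j = i then 1 else 0))"
        using g inj i by (simp add: linear_sum linear_scale) (intro sum.cong, auto simp: inj_on_def)
      also have "\<dots> = a i" using i assms(2) by (simp add: if_distrib cong: if_cong)
      finally show ?thesis
        using C(2)[of "\<Sum>j\<in>I. a j *\<^sub>R v j"] by (force intro: span_sum span_scale span_base)
    qed
    with C(1) show ?thesis by blast
  qed
  then obtain C where C: "\<And>i. i \<in> I \<Longrightarrow> C i \<ge> 0"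
    "\<And>i a. i \<in> I \<Longrightarrow> \<bar>a i\<bar> \<le> C i * norm (\<Sum>j\<in>I. a j *\<^sub>R v j)"
    by metis
  \<comment> \<open>The summand 1 keeps \<open>K\<close> positive when I is empty or all bounds
    vanish.\<close>
  define K where "K = (\<Sum>i\<in>I. C i) + 1"
  have "K > 0" unfolding K_def using C(1) by (smt (verit) sum_nonneg)
  have "(\<Sum>i\<in>I. \<bar>a i\<bar>) \<le> K * norm (\<Sum>j\<in>I. a j *\<^sub>R v j)" for a
  proof -
    have "(\<Sum>i\<in>I. \<bar>a i\<bar>) \<le> (\<Sum>i\<in>I. C i) * norm (\<Sum>j\<in>I. a j *\<^sub>R v j)"
      unfolding sum_distrib_right by (intro sum_mono C(2))
    also have "\<dots> \<le> K * norm (\<Sum>j\<in>I. a j *\<^sub>R v j)"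
      unfolding K_def by (intro mult_right_mono) auto
    finally show ?thesis .
  qed
  then show thesis using that[of "1 / K"] \<open>K > 0\<close> by (simp add: field_simps)
qed

text \<open>To the right of a the factor exp(-C t) makes E nonincreasing, to the left exp(C t) makes
  it nondecreasing; on both sides E is squeezed between 0 and its value 0 at a.\<close>

lemma Gronwall_zero:
  fixes E E' :: "real \<Rightarrow> real"
  assumes der: "\<And>t. \<bar>t - a\<bar> \<le> \<delta> \<Longrightarrow> (E has_real_derivative E' t) (at t)"
    and bound: "\<And>t. \<bar>t - a\<bar> \<le> \<delta> \<Longrightarrow> \<bar>E' t\<bar> \<le> C * E t"
    and E: "E a = 0" "\<And>t. E t \<ge> 0" and t: "\<bar>t - a\<bar> \<le> \<delta>"
  shows "E t = 0"
proof (cases "a \<le> t")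
  case True
  have "E t * exp (- (C * t)) \<le> E a * exp (- (C * a))"
  proof (rule DERIV_nonpos_imp_nonincreasing[OF True])
    fix x assume x: "a \<le> x" "x \<le> t"
    then have "\<bar>x - a\<bar> \<le> \<delta>" using t by auto
    note d = der[OF this] and b = bound[OF this]
    have "((\<lambda>x. E x * exp (- (C * x))) has_real_derivative (E' x - C * E x) * exp (- (C * x))) (at x)"
      by (rule derivative_eq_intros d refl | simp add: algebra_simps)+
    moreover have "(E' x - C * E x) * exp (- (C * x)) \<le> 0"
      using b by (simp add: mult_le_0_iff)
    ultimately show "\<exists>y. ((\<lambda>x. E x * exp (- (C * x))) has_real_derivative y) (at x) \<and> y \<le> 0" by blast
  qed
  then show ?thesis using E(1) E(2)[of t] by (simp add: mult_le_0_iff)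
next
  case False
  then have le: "t \<le> a" by simp
  have "E t * exp (C * t) \<le> E a * exp (C * a)"
  proof (rule DERIV_nonneg_imp_nondecreasing[OF le])
    fix x assume x: "t \<le> x" "x \<le> a"
    then have "\<bar>x - a\<bar> \<le> \<delta>" using t by auto
    note d = der[OF this] and b = bound[OF this]
    have "((\<lambda>x. E x * exp (C * x)) has_real_derivative (E' x + C * E x) * exp (C * x)) (at x)"
      by (rule derivative_eq_intros d refl | simp add: algebra_simps)+
    moreover have "0 \<le> (E' x + C * E x) * exp (C * x)"
      using b by simp
    ultimately show "\<exists>y. ((\<lambda>x. E x * exp (C * x)) has_real_derivative y) (at x) \<and> 0 \<le> y" by blast
  qed
  then show ?thesis using E(1) E(2)[of t] by (simp add: mult_le_0_iff)
qed

lemma independent_card_ge_imp_span: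
  assumes "finite S" "V \<subseteq> span S" "card S \<le> card B" "B \<subseteq> V" "independent B"
  shows "V \<subseteq> span B"
proof
  fix x assume x: "x \<in> V"
  have B: "finite B" using independent_span_bound[OF assms(1,5)] assms by blast
  show "x \<in> span B"
  proof (rule ccontr)
    assume "x \<notin> span B"
    then have "independent (insert x B)" "x \<notin> B"
      using assms(5) independent_insertI span_base by blast+
    moreover have "insert x B \<subseteq> span S" using x assms by blast
    ultimately have "card (insert x B) \<le> card S" using independent_span_bound[OF assms(1)] by blast
    then show False using assms(3) B \<open>x \<notin> B\<close> by simp
  qed
qed

text \<open>\<open>Q\<close> subtracts the Fourier sum over an orthogonal spanning set. A zero
  vector in that set does no harm, since division by zero gives zero. With \<open>Q\<close>, the
  distance to a span becomes a differentiable quadratic quantity.\<close>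

lemma orthogonal_complement_projection:
  fixes B :: "'a::real_inner set"
  assumes "finite B"
  shows "\<exists>Q :: 'a \<Rightarrow> 'a. bounded_linear Q \<and> (\<forall>x. Q x = 0 \<longleftrightarrow> x \<in> span B)"
proof -
  obtain C where C: "finite C" "span C = span B" "pairwise orthogonal C"
    using basis_orthogonal[OF assms] by blast
  define Q where "Q x = x - (\<Sum>b\<in>C. (inner b x / inner b b) *\<^sub>R b)" for x
  have lin: "bounded_linear Q"
    unfolding Q_def [abs_def] divide_inverse
    by (intro bounded_linear_intros bounded_linear_sum)
  have in_span: "x - Q x \<in> span C" for x
    by (simp add: Q_def span_sum span_scale span_base)
  have "x \<in> span B" if "Q x = 0" for x using in_span[of x] that C(2) by simp
  moreover have "Q x = 0" if "x \<in> span B" for x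
  proof -
    have "Q x \<in> span C" using span_diff[of x C "x - Q x"] in_span[of x] that C(2) by simp
    have orth: "inner (Q x) c = 0" if c: "c \<in> C" for c
    proof -
      have "(\<Sum>b\<in>C. inner b x / inner b b * inner b c) = (\<Sum>b\<in>C. if b = c then inner c x else 0)"
        using C(3) c by (intro sum.cong) (auto simp: pairwise_def orthogonal_def)
      then show ?thesis
        using c C(1) by (simp add: Q_def inner_diff_left inner_sum_left inner_commute[of x])
    qed
    have "inner (Q x) y = 0" if "y \<in> span C" for y
      using that by (induction rule: span_induct_alt) (simp_all add: inner_add_right orth)
    from this[OF \<open>Q x \<in> span C\<close>] show ?thesis by simp
  qed
  ultimately show ?thesis using lin by blast
qed

text \<open>With \<open>Q\<close> the projection off the span at t0, the energy E, the sum of the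
  squared norms of \<open>Q (g i t)\<close>, vanishes at t0. Expanding g' in the frame gives a bound
  of its derivative by a multiple of E, so Gronwall applies. The point to secure is a uniform bound
  of the expansion coefficients near t0; equality of the spans then follows by counting.\<close>

lemma span_moving_frame_locally_constant:
  fixes g g' :: "'i \<Rightarrow> real \<Rightarrow> 'a::real_inner"
  assumes I: "finite I"
    and der: "\<And>i t. i \<in> I \<Longrightarrow> (g i has_vector_derivative g' i t) (at t)"
    and cont: "\<And>i t. i \<in> I \<Longrightarrow> isCont (g' i) t"
    and J: "open J" "t0 \<in> J"
    and tangent: "\<And>i t. i \<in> I \<Longrightarrow> t \<in> J \<Longrightarrow> g' i t \<in> span ((\<lambda>j. g j t) ` I)"
    and indep: "\<And>t. independent_family (\<lambda>i. g i t) I"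
  shows "\<forall>\<^sub>F t in at t0. span ((\<lambda>i. g i t) ` I) = span ((\<lambda>i. g i t0) ` I)"
proof -
  let ?W = "span ((\<lambda>i. g i t0) ` I)"
  obtain Q :: "'a \<Rightarrow> 'a" where Q: "bounded_linear Q" "\<And>x. Q x = 0 \<longleftrightarrow> x \<in> ?W"
    using orthogonal_complement_projection[OF finite_imageI[OF I], of "\<lambda>i. g i t0"] by auto
  have "\<exists>\<kappa>>0. \<forall>a. \<kappa> * (\<Sum>i\<in>I. \<bar>a i\<bar>) \<le> norm (\<Sum>i\<in>I. a i *\<^sub>R g i t0)"
    by (rule independent_family_coercive[OF indep[of t0] I]) auto
  then obtain \<kappa> where \<kappa>: "\<kappa> > 0" "\<And>a. \<kappa> * (\<Sum>i\<in>I. \<bar>a i\<bar>) \<le> norm (\<Sum>i\<in>I. a i *\<^sub>R g i t0)"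
    by auto
  define K where "K = Max (insert 0 ((\<lambda>i. norm (g' i t0)) ` I)) + 1"
  have K: "norm (g' i t0) < K" if "i \<in> I" for i
  proof -
    have "norm (g' i t0) \<le> Max (insert 0 ((\<lambda>i. norm (g' i t0)) ` I))"
      using I that by (intro Max_ge) auto
    then show ?thesis by (simp add: K_def)
  qed
  have "\<forall>\<^sub>F t in nhds t0. t \<in> J \<and> (\<forall>i\<in>I. norm (g' i t) < K \<and> dist (g i t) (g i t0) < \<kappa> / 2)"
  proof (intro eventually_conj eventually_ball_finite ballI I)
    show "\<forall>\<^sub>F t in nhds t0. t \<in> J" using J by (rule eventually_nhds_in_open)
    fix i assume i: "i \<in> I"
    have "((\<lambda>t. norm (g' i t)) \<longlongrightarrow> norm (g' i t0)) (nhds t0)"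
      using cont[OF i] unfolding tendsto_nhds_iff by (auto simp: isCont_def intro: tendsto_norm)
    then show "\<forall>\<^sub>F t in nhds t0. norm (g' i t) < K" using K[OF i] by (rule order_tendstoD)
    have "isCont (g i) t0" using der[OF i] has_vector_derivative_continuous by blast
    then have "(g i \<longlongrightarrow> g i t0) (nhds t0)" unfolding tendsto_nhds_iff by (simp add: isCont_def)
    then show "\<forall>\<^sub>F t in nhds t0. dist (g i t) (g i t0) < \<kappa> / 2" using \<kappa>(1) by (intro tendstoD) auto
  qed
  then obtain \<epsilon> where \<epsilon>: "\<epsilon> > 0" "\<And>t. dist t t0 < \<epsilon> \<Longrightarrow> t \<in> J"
    "\<And>t i. dist t t0 < \<epsilon> \<Longrightarrow> i \<in> I \<Longrightarrow> norm (g' i t) < K"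
    "\<And>t i. dist t t0 < \<epsilon> \<Longrightarrow> i \<in> I \<Longrightarrow> dist (g i t) (g i t0) < \<kappa> / 2"
    unfolding eventually_nhds_metric by blast
  define \<delta> where "\<delta> = \<epsilon> / 2"
  \<comment> \<open>The frame at t differs from the frame at t0 by less than \<kappa>/2 in each
    vector, so coercivity at t0 gives \<kappa> times the sum of |a j| at most K plus half of the
    same quantity. Absorbing that half leaves the bound 2 K / \<kappa>.\<close>
  define L where "L = 2 * K / \<kappa>"
  have coeff: "\<exists>a. g' i t = (\<Sum>j\<in>I. a j *\<^sub>R g j t) \<and> (\<forall>j\<in>I. \<bar>a j\<bar> \<le> L)"
    if i: "i \<in> I" and t: "dist t t0 < \<epsilon>" for i t
  proof -
    have inj: "inj_on (\<lambda>j. g j t) I" using indep by (simp add: independent_family_def)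
    obtain c where "g' i t = (\<Sum>v\<in>(\<lambda>j. g j t) ` I. c v *\<^sub>R v)"
      using tangent[OF i \<epsilon>(2)[OF t]] span_finite[of "(\<lambda>j. g j t) ` I"] I by auto
    then have eq: "g' i t = (\<Sum>j\<in>I. c (g j t) *\<^sub>R g j t)"
      using inj by (simp add: sum.reindex)
    define a where "a j = c (g j t)" for j
    have "\<kappa> * (\<Sum>j\<in>I. \<bar>a j\<bar>) \<le> norm (\<Sum>j\<in>I. a j *\<^sub>R g j t0)" by (rule \<kappa>(2))
    also have "(\<Sum>j\<in>I. a j *\<^sub>R g j t0) = g' i t - (\<Sum>j\<in>I. a j *\<^sub>R (g j t - g j t0))"
      by (simp add: eq a_def scaleR_diff_right sum_subtractf)
    also have "norm \<dots> \<le> norm (g' i t) + norm (\<Sum>j\<in>I. a j *\<^sub>R (g j t - g j t0))"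
      by (rule norm_triangle_ineq4)
    also have "norm (\<Sum>j\<in>I. a j *\<^sub>R (g j t - g j t0)) \<le> (\<Sum>j\<in>I. \<bar>a j\<bar> * (\<kappa> / 2))"
    proof (rule sum_norm_le)
      fix j assume "j \<in> I"
      then show "norm (a j *\<^sub>R (g j t - g j t0)) \<le> \<bar>a j\<bar> * (\<kappa> / 2)"
        using mult_left_mono[OF less_imp_le[OF \<epsilon>(4)[OF t, of j]], of "\<bar>a j\<bar>"] by (simp add: dist_norm)
    qed
    also have "\<dots> = \<kappa> * (\<Sum>j\<in>I. \<bar>a j\<bar>) / 2" by (simp add: sum_distrib_left mult.commute flip: sum_divide_distrib)
    finally have "\<kappa> * (\<Sum>j\<in>I. \<bar>a j\<bar>) \<le> 2 * K" using \<epsilon>(3)[OF t i] by simp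
    then have le: "(\<Sum>j\<in>I. \<bar>a j\<bar>) \<le> L" using \<kappa>(1) by (simp add: L_def field_simps)
    have "\<bar>a j\<bar> \<le> L" if "j \<in> I" for j
      using le member_le_sum[OF that, of "\<lambda>j. \<bar>a j\<bar>"] I by simp
    with eq show ?thesis by (auto simp: a_def)
  qed
  define q where "q i t = Q (g i t)" for i t
  define E where "E t = (\<Sum>i\<in>I. inner (q i t) (q i t))" for t
  define E' where "E' t = (\<Sum>i\<in>I. 2 * inner (q i t) (Q (g' i t)))" for t
  have E_der: "(E has_real_derivative E' t) (at t)" for t
    unfolding E_def [abs_def] E'_def
  proof (intro DERIV_sum)
    fix i assume "i \<in> I"
    then have "(q i has_vector_derivative Q (g' i t)) (at t)"
      unfolding q_def [abs_def] by (intro bounded_linear.has_vector_derivative[OF Q(1)] der)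
    from bounded_bilinear.has_vector_derivative[OF bounded_bilinear_inner this this]
    show "((\<lambda>t. inner (q i t) (q i t)) has_real_derivative 2 * inner (q i t) (Q (g' i t))) (at t)"
      by (simp add: has_real_derivative_iff_has_vector_derivative inner_commute)
  qed
  have E_bound: "\<bar>E' t\<bar> \<le> (2 * L * card I) * E t" if t: "dist t t0 < \<epsilon>" for t
  proof -
    have "\<bar>2 * inner (q i t) (Q (g' i t))\<bar> \<le> (\<Sum>j\<in>I. L * (inner (q i t) (q i t) + inner (q j t) (q j t)))"
      if i: "i \<in> I" for i
    proof -
      obtain a where a: "g' i t = (\<Sum>j\<in>I. a j *\<^sub>R g j t)" "\<And>j. j \<in> I \<Longrightarrow> \<bar>a j\<bar> \<le> L"
        using coeff[OF i t] by blast
      have "2 * inner (q i t) (Q (g' i t)) = (\<Sum>j\<in>I. 2 * (a j * inner (q i t) (q j t)))"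
        unfolding a(1) q_def
        by (simp add: linear_sum[OF bounded_linear.linear[OF Q(1)]] linear_scale[OF bounded_linear.linear[OF Q(1)]]
            inner_sum_right sum_distrib_left)
      also have "\<bar>\<dots>\<bar> \<le> (\<Sum>j\<in>I. \<bar>2 * (a j * inner (q i t) (q j t))\<bar>)" by (rule sum_abs)
      also have "\<dots> \<le> (\<Sum>j\<in>I. L * (inner (q i t) (q i t) + inner (q j t) (q j t)))"
      proof (rule sum_mono)
        fix j assume j: "j \<in> I"
        have "2 * \<bar>inner (q i t) (q j t)\<bar> \<le> 2 * (norm (q i t) * norm (q j t))"
          using Cauchy_Schwarz_ineq2[of "q i t" "q j t"] by simp
        also have "\<dots> \<le> norm (q i t) ^ 2 + norm (q j t) ^ 2"
          using sum_squares_bound[of "norm (q i t)" "norm (q j t)"] by simp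
        finally have "2 * \<bar>inner (q i t) (q j t)\<bar> \<le> inner (q i t) (q i t) + inner (q j t) (q j t)"
          by (simp add: power2_norm_eq_inner)
        then have "\<bar>a j\<bar> * (2 * \<bar>inner (q i t) (q j t)\<bar>) \<le> L * (inner (q i t) (q i t) + inner (q j t) (q j t))"
          using a(2)[OF j] by (intro mult_mono) auto
        then show "\<bar>2 * (a j * inner (q i t) (q j t))\<bar> \<le> L * (inner (q i t) (q i t) + inner (q j t) (q j t))"
          by (simp add: abs_mult mult.left_commute)
      qed
      finally show ?thesis .
    qed
    then have "(\<Sum>i\<in>I. \<bar>2 * inner (q i t) (Q (g' i t))\<bar>) \<le>
        (\<Sum>i\<in>I. \<Sum>j\<in>I. L * (inner (q i t) (q i t) + inner (q j t) (q j t)))"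
      by (rule sum_mono)
    also have "\<dots> = (2 * L * card I) * E t"
      by (simp add: E_def distrib_left sum.distrib flip: sum_distrib_left)
    finally show ?thesis unfolding E'_def by (rule order_trans[OF sum_abs])
  qed
  have "span ((\<lambda>i. g i t) ` I) = ?W" if t: "dist t t0 < \<delta>" for t
  proof -
    have "q i t0 = 0" if "i \<in> I" for i
      using that by (simp add: q_def Q(2) span_base)
    then have "E t0 = 0" by (simp add: E_def)
    have "E t = 0"
    proof (rule Gronwall_zero[of t0 \<delta> E E' "2 * L * card I"])
      show "(E has_real_derivative E' s) (at s)" for s by (rule E_der)
      show "\<bar>E' s\<bar> \<le> (2 * L * card I) * E s" if "\<bar>s - t0\<bar> \<le> \<delta>" for s
        using that \<epsilon>(1) by (intro E_bound) (simp add: dist_real_def \<delta>_def)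
      show "0 \<le> E s" for s unfolding E_def by (intro sum_nonneg) simp
    qed (use t \<open>E t0 = 0\<close> in \<open>auto simp: dist_real_def\<close>)
    then have "q i t = 0" if "i \<in> I" for i
      using that I by (simp add: E_def sum_nonneg_eq_0_iff)
    then have sub: "(\<lambda>i. g i t) ` I \<subseteq> ?W" by (auto simp: q_def Q(2))
    have "card ((\<lambda>i. g i s) ` I) = card I" for s
      using indep by (simp add: independent_family_def card_image)
    then have card_le: "card ((\<lambda>i. g i t0) ` I) \<le> card ((\<lambda>i. g i t) ` I)" by simp
    have ind: "independent ((\<lambda>i. g i t) ` I)" using indep by (simp add: independent_family_def)
    have "?W \<subseteq> span ((\<lambda>i. g i t) ` I)"
      by (rule independent_card_ge_imp_span[OF finite_imageI[OF I] order_refl card_le sub ind])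
    from subset_antisym[OF span_minimal[OF sub subspace_span] this] show ?thesis .
  qed
  moreover have "\<delta> > 0" using \<epsilon>(1) by (simp add: \<delta>_def)
  ultimately show ?thesis unfolding eventually_at by blast
qed

subsection \<open>Linearity of derivatives along curves\<close>

lemma has_vector_derivative_iff_quotient:
  "(f has_vector_derivative D) (at t) \<longleftrightarrow> ((\<lambda>s. (f (t + s) - f t) /\<^sub>R s) \<longlongrightarrow> D) (at 0)"
proof -
  have "norm ((f (t + s) - f t) /\<^sub>R s - D) = norm (f (t + s) - f t - s *\<^sub>R D) / norm s" if "s \<noteq> 0" for s
  proof -
    have "(f (t + s) - f t) /\<^sub>R s - D = (f (t + s) - f t - s *\<^sub>R D) /\<^sub>R s"
      using that by (simp add: algebra_simps)
    then show ?thesis by (simp add: divide_inverse_commute)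
  qed
  then have "((\<lambda>s. norm ((f (t + s) - f t) /\<^sub>R s - D)) \<longlongrightarrow> 0) (at 0) \<longleftrightarrow>
      ((\<lambda>s. norm (f (t + s) - f t - s *\<^sub>R D) / norm s) \<longlongrightarrow> 0) (at 0)"
    by (intro filterlim_cong) (auto simp: eventually_at_filter)
  then show ?thesis
    by (simp add: has_vector_derivative_def has_derivative_at bounded_linear_scaleR_left
        tendsto_norm_zero_iff LIM_zero_iff)
qed

lemma smooth_curve_euclidean_iff:
  "smooth_curve euclidean c \<longleftrightarrow>
     (\<exists>D. D 0 = c \<and> (\<forall>n t. (D n has_vector_derivative D (Suc n) t) (at t)))"
  by (simp add: smooth_curve_def has_vector_derivative_iff_quotient)

section \<open>Flat functions at the origin\<close>

text \<open>A complex exponent covers both coordinates of the test curve: \<kappa> = 3 gives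
  exp(-3/t), and the imaginary part for \<kappa> = 1 - i is exp(-1/t) sin(1/t). The polynomial in
  1/t makes the class closed under differentiation.\<close>

definition flat :: "complex \<Rightarrow> complex poly \<Rightarrow> real \<Rightarrow> complex" where
  "flat \<kappa> P t = (if t \<le> 0 then 0 else exp (- (\<kappa> / of_real t)) * poly P (1 / of_real t))"

text \<open>Differentiating exp(-\<kappa>/t) P(1/t) produces the factor 1/t^2, here the polynomial
  \<open>[:0, 0, 1:]\<close>, times (\<kappa> P - P')(1/t).\<close>

definition flat_step :: "complex \<Rightarrow> complex poly \<Rightarrow> complex poly" where
  "flat_step \<kappa> P = [:0, 0, 1:] * (smult \<kappa> P - pderiv P)"

lemma exp_times_poly_tendsto_0:
  assumes "Re \<kappa> > 0"
  shows "((\<lambda>x::real. exp (- (\<kappa> * of_real x)) * poly P (of_real x)) \<longlongrightarrow> 0) at_top"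
proof -
  have mono: "((\<lambda>x::real. exp (- (\<kappa> * of_real x)) * of_real x ^ i) \<longlongrightarrow> 0) at_top" for i
  proof (rule tendsto_norm_zero_cancel)
    have "filterlim (\<lambda>x. Re \<kappa> * x) at_top at_top"
      using assms filterlim_tendsto_pos_mult_at_top[OF tendsto_const assms filterlim_ident] by simp
    from filterlim_compose[OF tendsto_power_div_exp_0 this, of i]
    have "((\<lambda>x. (Re \<kappa> * x) ^ i / exp (Re \<kappa> * x) / Re \<kappa> ^ i) \<longlongrightarrow> 0 / Re \<kappa> ^ i) at_top"
      using assms by (intro tendsto_intros) auto
    moreover have "\<forall>\<^sub>F x in at_top. (Re \<kappa> * x) ^ i / exp (Re \<kappa> * x) / Re \<kappa> ^ i =
        norm (exp (- (\<kappa> * of_real x)) * complex_of_real x ^ i)"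
      using eventually_gt_at_top[of 0]
    proof eventually_elim
      case (elim x)
      have "norm (exp (- (\<kappa> * complex_of_real x))) = inverse (exp (Re \<kappa> * x))"
        unfolding norm_exp_eq_Re by (simp add: exp_minus)
      then show ?case using assms elim
        by (simp only: norm_mult norm_power) (simp add: power_mult_distrib field_simps)
    qed
    ultimately show "((\<lambda>x. norm (exp (- (\<kappa> * of_real x)) * complex_of_real x ^ i)) \<longlongrightarrow> 0) at_top"
      by (simp add: filterlim_cong)
  qed
  have "((\<lambda>x::real. \<Sum>i\<le>degree P. coeff P i * (exp (- (\<kappa> * of_real x)) * of_real x ^ i))
          \<longlongrightarrow> (\<Sum>i\<le>degree P. coeff P i * 0)) at_top"
    by (intro tendsto_sum tendsto_mult[OF tendsto_const] mono)
  then show ?thesis by (simp add: poly_altdef sum_distrib_left mult.left_commute)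
qed

lemma flat_has_vector_derivative:
  assumes \<kappa>: "Re \<kappa> > 0"
  shows "(flat \<kappa> P has_vector_derivative flat \<kappa> (flat_step \<kappa> P) t) (at t)"
proof -
  consider "t < 0" | "t = 0" | "t > 0" by linarith
  then show ?thesis
  proof cases
    case 1
    have "((\<lambda>_. 0) has_vector_derivative flat \<kappa> (flat_step \<kappa> P) t) (at t)"
      using 1 by (simp add: flat_def)
    then show ?thesis
      by (rule has_vector_derivative_transform_within_open[of _ _ _ "{..<0}"])
        (use 1 in \<open>auto simp: flat_def\<close>)
  next
    case 3
    define z where "z = complex_of_real t"
    have z: "z \<noteq> 0" using 3 by (simp add: z_def)
    have inv: "((\<lambda>z. 1 / z) has_field_derivative - (1 / z\<^sup>2)) (at z)"
      using z by (auto intro!: derivative_eq_intros simp: power2_eq_square)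
    have "((\<lambda>z. exp (- (\<kappa> * (1 / z))) * poly P (1 / z)) has_field_derivative
        exp (- (\<kappa> * (1 / z))) * (- (\<kappa> * - (1 / z\<^sup>2))) * poly P (1 / z) +
        poly (pderiv P) (1 / z) * - (1 / z\<^sup>2) * exp (- (\<kappa> * (1 / z)))) (at z)"
      by (intro DERIV_mult' DERIV_mult DERIV_chain2[OF poly_DERIV inv] DERIV_chain2[OF DERIV_exp]
          DERIV_minus DERIV_cmult inv)
    moreover have "exp (- (\<kappa> * (1 / z))) * (- (\<kappa> * - (1 / z\<^sup>2))) * poly P (1 / z) +
        poly (pderiv P) (1 / z) * - (1 / z\<^sup>2) * exp (- (\<kappa> * (1 / z))) = flat \<kappa> (flat_step \<kappa> P) t"
      using 3 by (simp add: flat_def flat_step_def algebra_simps power2_eq_square flip: z_def)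
    ultimately have "((\<lambda>z. exp (- (\<kappa> / z)) * poly P (1 / z)) has_field_derivative
        flat \<kappa> (flat_step \<kappa> P) t) (at (complex_of_real t))"
      by (simp add: z_def)
    from has_vector_derivative_real_field[OF this] show ?thesis
      by (rule has_vector_derivative_transform_within_open[of _ _ _ "{0<..}"])
        (use 3 in \<open>auto simp: flat_def\<close>)
  next
    case 2
    \<comment> \<open>For s = 1/x the difference quotient at 0 is exp(-\<kappa> x) x P(x);
      \<open>pCons 0 P\<close> supplies the extra factor x.\<close>
    have "((\<lambda>x. exp (- (\<kappa> * complex_of_real x)) * poly (pCons 0 P) (of_real x)) \<longlongrightarrow> 0) at_top"
      by (rule exp_times_poly_tendsto_0[OF \<kappa>])
    moreover have "\<forall>\<^sub>F x in at_top. exp (- (\<kappa> * complex_of_real x)) * poly (pCons 0 P) (of_real x) =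
        flat \<kappa> P (inverse x) /\<^sub>R inverse x"
      using eventually_gt_at_top[of 0]
      by eventually_elim (simp add: flat_def scaleR_conv_of_real field_simps)
    ultimately have "((\<lambda>x. flat \<kappa> P (inverse x) /\<^sub>R inverse x) \<longlongrightarrow> 0) at_top"
      by (simp add: filterlim_cong)
    then have R: "((\<lambda>s. flat \<kappa> P s /\<^sub>R s) \<longlongrightarrow> 0) (at_right 0)"
      by (simp add: filterlim_at_right_to_top)
    have "\<forall>\<^sub>F s in at_left 0. (0::complex) = flat \<kappa> P s /\<^sub>R s"
      by (auto simp: eventually_at_filter flat_def)
    then have "((\<lambda>s. flat \<kappa> P s /\<^sub>R s) \<longlongrightarrow> 0) (at_left 0)"
      by (rule Lim_transform_eventually[OF tendsto_const])
    with R show ?thesis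
      unfolding has_vector_derivative_iff_quotient
      by (intro filterlim_split_at) (simp_all add: 2 flat_def)
  qed
qed

lemma flat_smooth:
  assumes "Re \<kappa> > 0"
  obtains D where "D 0 = flat \<kappa> 1" "\<And>n t. (D n has_vector_derivative D (Suc n) t) (at t)"
proof
  show "(\<lambda>n. flat \<kappa> ((flat_step \<kappa> ^^ n) 1)) 0 = flat \<kappa> 1" by simp
qed (simp add: flat_has_vector_derivative[OF assms])

text \<open>For t > 0 the coordinates are exp(-3/t) along e and exp(-1/t) sin(1/t) along u. The
  exponents 3 and 1 make them comparable exactly when the sine has size exp(-2/t).\<close>

lemma smooth_curve_flat_plane:
  fixes x u e :: "'a::real_normed_vector"
  shows "smooth_curve euclidean (\<lambda>t. x + Re (flat 3 1 t) *\<^sub>R e + Im (flat (1 - \<i>) 1 t) *\<^sub>R u)"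
proof -
  obtain D where D: "D 0 = flat 3 1" "\<And>n t. (D n has_vector_derivative D (Suc n) t) (at t)"
    using flat_smooth[of 3] by auto
  obtain G where G: "G 0 = flat (1 - \<i>) 1" "\<And>n t. (G n has_vector_derivative G (Suc n) t) (at t)"
    using flat_smooth[of "1 - \<i>"] by auto
  define c where "c n t = (if n = 0 then x else 0) + Re (D n t) *\<^sub>R e + Im (G n t) *\<^sub>R u" for n t
  have "(c n has_vector_derivative c (Suc n) t) (at t)" for n t
  proof -
    have "((\<lambda>t. Re (D n t)) has_vector_derivative Re (D (Suc n) t)) (at t)"
      by (rule bounded_linear.has_vector_derivative[OF bounded_linear_Re D(2)])
    moreover have "((\<lambda>t. Im (G n t)) has_vector_derivative Im (G (Suc n) t)) (at t)"
      by (rule bounded_linear.has_vector_derivative[OF bounded_linear_Im G(2)])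
    ultimately have "((\<lambda>t. (if n = 0 then x else 0) + Re (D n t) *\<^sub>R e + Im (G n t) *\<^sub>R u)
        has_vector_derivative 0 + Re (D (Suc n) t) *\<^sub>R e + Im (G (Suc n) t) *\<^sub>R u) (at t)"
      by (intro has_vector_derivative_add has_vector_derivative_const
        bounded_linear.has_vector_derivative[OF bounded_linear_scaleR_left])
    then show ?thesis by (simp add: c_def [abs_def])
  qed
  then show ?thesis unfolding smooth_curve_euclidean_iff
    by (intro exI[of _ c]) (auto simp: c_def D G fun_eq_iff)
qed

text \<open>Both quotients are values of G' by the mean value theorem, and a third application
  compares these values. Unequal steps are allowed because the crossing times of the curve are not
  symmetric.\<close>

lemma second_difference_bound:
  fixes G G' G'' :: "real \<Rightarrow> real"
  assumes G: "\<And>x. a - r \<le> x \<Longrightarrow> x \<le> a + q \<Longrightarrow> (G has_real_derivative G' x) (at x)"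
    and G': "\<And>x. a - r \<le> x \<Longrightarrow> x \<le> a + q \<Longrightarrow> (G' has_real_derivative G'' x) (at x)"
    and M: "\<And>x. a - r \<le> x \<Longrightarrow> x \<le> a + q \<Longrightarrow> \<bar>G'' x\<bar> \<le> M"
    and pos: "q > 0" "r > 0"
  shows "\<bar>(G (a + q) - G a) / q - (G a - G (a - r)) / r\<bar> \<le> M * (q + r)"
proof -
  obtain z1 where z1: "a < z1" "z1 < a + q" "G (a + q) - G a = q * G' z1"
    using MVT2[of a "a + q" G G'] G pos by auto
  obtain z2 where z2: "a - r < z2" "z2 < a" "G a - G (a - r) = r * G' z2"
    using MVT2[of "a - r" a G G'] G pos by auto
  obtain z3 where z3: "z2 < z3" "z3 < z1" "G' z1 - G' z2 = (z1 - z2) * G'' z3"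
    using MVT2[of z2 z1 G' G''] G' z1 z2 by auto
  have "\<bar>G' z1 - G' z2\<bar> = (z1 - z2) * \<bar>G'' z3\<bar>" using z1 z2 z3 by (simp add: abs_mult)
  also have "\<dots> \<le> (q + r) * M"
    using z1 z2 z3 M[of z3] by (intro mult_mono) auto
  finally show ?thesis using z1 z2 pos by (simp add: mult.commute)
qed

text \<open>
  The curve runs through \<open>x\<close> and, for \<open>s = 1 / t\<close> near a multiple \<open>N\<close> of \<open>2 * pi\<close>, crosses the sector
  spanned by \<open>v\<close> and \<open>w\<close>: it meets the rays through \<open>w\<close>, \<open>v + w\<close> and \<open>v\<close> at \<open>N - r\<close>, \<open>N\<close> and \<open>N + q\<close>, where \<open>q\<close>
  and \<open>r\<close> are of order \<open>exp (- 2 * N)\<close>, at distances of order \<open>exp (- 3 * N)\<close> from \<open>x\<close>. A second difference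
  of the smooth function \<open>f \<circ> \<gamma>\<close> is of order \<open>exp (- 4 * N)\<close>, hence negligible against the distance.
\<close>

lemma additive_directional_derivative:
  fixes f :: "'a::real_normed_vector \<Rightarrow> real"
  assumes smooth: "\<And>\<gamma>. smooth_curve euclidean \<gamma> \<Longrightarrow> smooth_curve euclidean (f \<circ> \<gamma>)"
    and a: "((\<lambda>s. (f (x + s *\<^sub>R v) - f x) / s) \<longlongrightarrow> a) (at 0)"
    and b: "((\<lambda>s. (f (x + s *\<^sub>R w) - f x) / s) \<longlongrightarrow> b) (at 0)"
    and c: "((\<lambda>s. (f (x + s *\<^sub>R (v + w)) - f x) / s) \<longlongrightarrow> c) (at 0)"
  shows "c = a + b"
proof -
  \<comment> \<open>In these coordinates the rays from x through v and w are reached when the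
    u-coordinate equals plus or minus the e-coordinate, and the ray through v + w when it
    vanishes.\<close>
  define e u where "e = (1/2) *\<^sub>R (v + w)" and "u = (1/2) *\<^sub>R (v - w)"
  have eu: "e + u = v" "e - u = w"
    by (simp_all add: e_def u_def flip: scaleR_add_right scaleR_diff_right)
  define \<gamma> where "\<gamma> t = x + Re (flat 3 1 t) *\<^sub>R e + Im (flat (1 - \<i>) 1 t) *\<^sub>R u" for t
  have \<gamma>: "\<gamma> (1 / s) = x + exp (- 3 * s) *\<^sub>R e + (exp (- s) * sin s) *\<^sub>R u" if "s > 0" for s
    using that by (simp add: \<gamma>_def flat_def Re_exp Im_exp algebra_simps)
  obtain D where D0: "D 0 = f \<circ> \<gamma>" and D: "\<And>n t. (D n has_real_derivative D (Suc n) t) (at t)"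
    using smooth[of \<gamma>] smooth_curve_flat_plane[of x e u]
    by (auto simp: smooth_curve_euclidean_iff \<gamma>_def [abs_def] has_real_derivative_iff_has_vector_derivative)
  have "\<exists>B. \<forall>t\<in>{0..1}. \<bar>D n t\<bar> \<le> B" for n
  proof -
    have "continuous_on {0..1} (D n)"
      using D by (meson DERIV_isCont continuous_at_imp_continuous_on)
    then have "bounded (D n ` {0..1})"
      by (intro compact_imp_bounded compact_continuous_image) auto
    then show ?thesis by (auto simp: bounded_iff)
  qed
  then obtain B where B: "\<And>n t. 0 \<le> t \<Longrightarrow> t \<le> 1 \<Longrightarrow> \<bar>D n t\<bar> \<le> B n"
    by (metis atLeastAtMost_iff)
  define M where "M = B 2 + 2 * B 1"
  have M0: "M \<ge> 0" using B[of 0 1] B[of 0 2] by (simp add: M_def)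
  define G where "G s = D 0 (1 / s)" for s
  define G' where "G' s = - (D 1 (1 / s) / s\<^sup>2)" for s
  define G'' where "G'' s = D 2 (1 / s) / s ^ 4 + 2 * D 1 (1 / s) / s ^ 3" for s
  have inv: "((\<lambda>s. 1 / s) has_real_derivative - (1 / s\<^sup>2)) (at s)" if "s \<ge> 1" for s :: real
    using that by (auto intro!: derivative_eq_intros simp: power2_eq_square)
  have Dinv: "((\<lambda>s. D n (1 / s)) has_real_derivative D (Suc n) (1 / s) * - (1 / s\<^sup>2)) (at s)"
    if "s \<ge> 1" for s n
    by (rule DERIV_chain2[OF D inv[OF that]])
  have G: "(G has_real_derivative G' s) (at s)" if "s \<ge> 1" for s
    using Dinv[OF that, of 0] by (simp add: G_def [abs_def] G'_def)
  have G': "(G' has_real_derivative G'' s) (at s)" if "s \<ge> 1" for s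
  proof -
    have "((\<lambda>s. - (D 1 (1 / s) / s\<^sup>2)) has_real_derivative
        - ((D 2 (1 / s) * - (1 / s\<^sup>2) * s\<^sup>2 - D 1 (1 / s) * (2 * s)) / (s\<^sup>2 * s\<^sup>2))) (at s)"
      using that Dinv[OF that, of 1]
      by (intro DERIV_minus DERIV_divide) (auto intro!: derivative_eq_intros simp: numeral_2_eq_2)
    moreover have "- ((D 2 (1 / s) * - (1 / s\<^sup>2) * s\<^sup>2 - D 1 (1 / s) * (2 * s)) / (s\<^sup>2 * s\<^sup>2)) = G'' s"
      using that by (simp add: G''_def field_simps power2_eq_square power4_eq_xxxx power3_eq_cube)
    ultimately show ?thesis by (simp add: G'_def [abs_def])
  qed
  have G'': "\<bar>G'' s\<bar> \<le> M" if s: "s \<ge> 1" for s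
  proof -
    have "\<bar>D n (1 / s)\<bar> / s ^ k \<le> B n" for n k
    proof -
      have "\<bar>D n (1 / s)\<bar> / s ^ k \<le> \<bar>D n (1 / s)\<bar>"
        using s by (simp add: divide_le_eq mult_le_cancel_left1 one_le_power)
      also have "\<dots> \<le> B n" using s by (intro B) auto
      finally show ?thesis .
    qed
    from this[of 2 4] this[of 1 3] s show ?thesis
      unfolding G''_def M_def
      by (intro order_trans[OF abs_triangle_ineq] add_mono) (auto simp: abs_mult)
  qed

  \<comment> \<open>Starting at \<open>Suc n\<close> gives N at least 2; as r is at most 1, the
    whole interval from N - r to N + q stays in s \<ge> 1, where the bound on G'' holds.\<close>
  define N where "N n = 2 * pi * real (Suc n)" for n
  have N: "N n \<ge> 2" for n
  proof -
    have "2 * 1 \<le> 2 * pi * real (Suc n)" using pi_gt3 by (intro mult_mono) auto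
    then show ?thesis by (simp add: N_def)
  qed
  have sin_ge: "\<delta> \<le> 2 * sin \<delta>" if \<delta>: "0 \<le> \<delta>" "\<delta> \<le> 1" for \<delta> :: real
  proof (cases "\<delta> = 0")
    case False
    obtain z where z: "0 < z" "z < \<delta>" "sin \<delta> - sin 0 = (\<delta> - 0) * cos z"
      using MVT2[of 0 \<delta> sin cos] \<delta> False by auto
    have "cos (pi / 3) \<le> cos z" using z \<delta> pi_gt3 by (intro cos_monotone_0_pi_le) auto
    with z show ?thesis using mult_left_mono[of "1/2" "cos z" \<delta>] by (simp add: cos_60)
  qed simp
  \<comment> \<open>The crossing condition exp(-s) |sin s| = exp(-3 s) at s = N + k \<delta>, solved
    by the intermediate value theorem; k = 1 gives the crossing after N and k = -1 the one before
    it.\<close>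
  have "\<exists>\<delta>>0. \<delta> \<le> 1 \<and> sin \<delta> = exp (- 2 * (N n + k * \<delta>))" if k: "\<bar>k\<bar> \<le> 1" for n k
  proof -
    have "exp (2 * (N n + k * 1)) * sin 1 \<ge> 1"
    proof -
      have "2 \<le> 1 + 2 * (N n + k)" using N[of n] abs_le_D2[OF k] by simp
      also have "\<dots> \<le> exp (2 * (N n + k))" by (rule exp_ge_add_one_self)
      finally have "2 \<le> exp (2 * (N n + k * 1))" by (simp only: mult_1_right)
      moreover have "1 / 2 \<le> sin (1::real)" using sin_ge[of 1] by simp
      ultimately have "2 * (1 / 2) \<le> exp (2 * (N n + k * 1)) * sin 1" by (intro mult_mono) auto
      then show ?thesis by simp
    qed
    then obtain \<delta> where \<delta>: "0 \<le> \<delta>" "\<delta> \<le> 1" "exp (2 * (N n + k * \<delta>)) * sin \<delta> = 1"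
      using IVT'[of "\<lambda>\<delta>. exp (2 * (N n + k * \<delta>)) * sin \<delta>" 0 1 1]
      by (force intro!: continuous_intros)
    have "exp (- 2 * (N n + k * \<delta>)) * (exp (2 * (N n + k * \<delta>)) * sin \<delta>) = sin \<delta>"
      by (simp flip: mult.assoc exp_add)
    with \<delta> have "sin \<delta> = exp (- 2 * (N n + k * \<delta>))" by simp
    with \<delta> show ?thesis by (intro exI[of _ \<delta>]) (auto simp: less_le)
  qed
  from this[of 1] this[of "-1"] obtain q r where
    q: "\<And>n. q n > 0" "\<And>n. q n \<le> 1" "\<And>n. sin (q n) = exp (- 2 * (N n + q n))" and
    r: "\<And>n. r n > 0" "\<And>n. r n \<le> 1" "\<And>n. sin (r n) = exp (- 2 * (N n - r n))"
    by simp metis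
  have N_lim: "filterlim N at_top sequentially"
    unfolding N_def by (intro filterlim_tendsto_pos_mult_at_top[OF tendsto_const]
        filterlim_compose[OF filterlim_real_sequentially filterlim_Suc]) auto
  have exp_lim: "(\<lambda>n. exp (- (k * N n))) \<longlonglongrightarrow> 0" if "k > 0" for k :: real
    using that by (intro filterlim_compose[OF exp_at_bot] filterlim_compose[OF filterlim_uminus_at_bot_at_top]
        filterlim_tendsto_pos_mult_at_top[OF tendsto_const _ N_lim])
  have q_le: "q n \<le> 2 * exp 2 * exp (- (2 * N n))" for n
  proof -
    have "q n \<le> 2 * exp (2 + - (2 * N n))"
      using sin_ge[of "q n"] q[of n] by (simp add: order_trans[OF _ mult_left_mono])
    then show ?thesis by (simp add: exp_diff exp_minus divide_inverse mult.assoc)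
  qed
  have r_le: "r n \<le> 2 * exp 2 * exp (- (2 * N n))" for n
  proof -
    have "exp (- 2 * (N n - r n)) \<le> exp (2 + - (2 * N n))" using r[of n] by simp
    then have "r n \<le> 2 * exp (2 + - (2 * N n))"
      using sin_ge[of "r n"] r[of n] by linarith
    then show ?thesis by (simp add: exp_diff exp_minus divide_inverse mult.assoc)
  qed
  have bnd_lim: "(\<lambda>n. 2 * exp 2 * exp (- (2 * N n))) \<longlonglongrightarrow> 0"
    using tendsto_mult_right_zero[OF exp_lim[of 2], of "2 * exp 2"] by simp
  have q0: "q \<longlonglongrightarrow> 0"
    by (rule tendsto_sandwich[OF _ _ tendsto_const bnd_lim]) (auto simp: q_le less_imp_le[OF q(1)])
  have r0: "r \<longlonglongrightarrow> 0"
    by (rule tendsto_sandwich[OF _ _ tendsto_const bnd_lim]) (auto simp: r_le less_imp_le[OF r(1)])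
  have sinc: "((\<lambda>h::real. sin h / h) \<longlongrightarrow> 1) (at 0)"
    using DERIV_sin[of "0::real"] by (simp add: DERIV_def)
  have q_at: "filterlim q (at 0) sequentially" and r_at: "filterlim r (at 0) sequentially"
    using q0 r0 q(1) r(1) by (auto simp: filterlim_at less_imp_neq[symmetric])
  \<comment> \<open>The two slopes in the second difference are divided by q and r. Only because q/r
    tends to 1 do the contributions of v and w enter the limit with equal weight.\<close>
  have ratio: "(\<lambda>n. q n / r n) \<longlonglongrightarrow> 1"
  proof -
    have "(\<lambda>n. exp (- 2 * (q n + r n)) * (sin (r n) / r n) / (sin (q n) / q n)) \<longlonglongrightarrow>
        exp (- 2 * (0 + 0)) * 1 / 1"
      by (intro tendsto_intros q0 r0 filterlim_compose[OF sinc q_at] filterlim_compose[OF sinc r_at]) auto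
    moreover have "exp (- 2 * (q n + r n)) * (sin (r n) / r n) / (sin (q n) / q n) = q n / r n" for n
    proof -
      have "exp (- 2 * (q n + r n)) * sin (r n) = sin (q n)"
        unfolding q(3) r(3) by (simp add: algebra_simps flip: exp_add)
      moreover have "sin (q n) \<noteq> 0" unfolding q(3) by simp
      ultimately show ?thesis using q(1)[of n] r(1)[of n] by (simp add: field_simps)
    qed
    ultimately show ?thesis by simp
  qed

  have sinN: "sin (N n + \<delta>) = sin \<delta>" "sin (N n - \<delta>) = - sin \<delta>" for n \<delta>
    using sin_2npi[of "Suc n"] cos_2npi[of "Suc n"] by (simp_all add: N_def sin_add sin_diff mult_ac)
  have exp_at: "filterlim (\<lambda>n. exp (- 3 * (N n + \<delta> n)) * k) (at 0) sequentially"
    if "\<delta> \<longlonglongrightarrow> 0" "k \<noteq> 0" for \<delta> k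
  proof -
    have "(\<lambda>n. exp (- (3 * N n)) * exp (- 3 * \<delta> n) * k) \<longlonglongrightarrow> 0 * exp (- 3 * 0) * k"
      using that by (intro tendsto_intros exp_lim) auto
    moreover have "exp (- (3 * N n)) * exp (- 3 * \<delta> n) = exp (- 3 * (N n + \<delta> n))" for n
      by (simp add: algebra_simps flip: exp_add)
    ultimately show ?thesis using that by (simp add: filterlim_at)
  qed
  define P where "P n = (f (x + exp (- 3 * (N n + q n)) *\<^sub>R v) - f x) / exp (- 3 * (N n + q n))" for n
  define Q where "Q n = (f (x + exp (- 3 * (N n - r n)) *\<^sub>R w) - f x) / exp (- 3 * (N n - r n))" for n
  define R where "R n = (f (x + exp (- 3 * N n) *\<^sub>R e) - f x) / exp (- 3 * N n)" for n
  have P: "P \<longlonglongrightarrow> a"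
    using filterlim_compose[OF a exp_at[OF q0, of 1]] by (simp add: P_def [abs_def])
  have Q: "Q \<longlonglongrightarrow> b"
    using filterlim_compose[OF b exp_at[of "\<lambda>n. - r n" 1]] tendsto_minus[OF r0] by (simp add: Q_def [abs_def])
  have half: "p / (y * (1 / 2)) / 2 = p / y" for p y :: real by simp
  have R: "R \<longlonglongrightarrow> c / 2"
    using tendsto_divide[OF filterlim_compose[OF c exp_at[of "\<lambda>_. 0" "1/2", OF tendsto_const]] tendsto_const[of 2]]
    unfolding half by (simp add: R_def [abs_def] e_def)
  \<comment> \<open>This is the second difference of G at N multiplied by q/E, where E = exp(-3 N).
    It tends to a + b - c, as e is half of v + w; it is also bounded by M (q + r) q / E, of order
    exp(-4 N) / exp(-3 N).\<close>
  define Y where "Y n = exp (- 3 * q n) * P n - R n - q n / r n * (R n - exp (3 * r n) * Q n)" for n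
  have "Y \<longlonglongrightarrow> exp (- 3 * 0) * a - c / 2 - 1 * (c / 2 - exp (3 * 0) * b)"
    unfolding Y_def [abs_def] by (intro tendsto_intros P Q R q0 r0 ratio)
  moreover have "exp (- 3 * 0) * a - c / 2 - 1 * (c / 2 - exp (3 * 0) * b) = a + b - c" by simp
  ultimately have Y1: "Y \<longlonglongrightarrow> a + b - c" by (simp only:)
  have "\<bar>Y n\<bar> \<le> M * 8 * exp 4 * exp (- N n)" for n
  proof -
    define E where "E = exp (- 3 * N n)"
    have E: "E > 0" and E': "exp (- (3 * N n)) = E" by (simp_all add: E_def)
    have "G (N n + q n) = f (x + exp (- 3 * (N n + q n)) *\<^sub>R v)"
    proof -
      have "exp (- (N n + q n)) * sin (N n + q n) = exp (- 3 * (N n + q n))"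
        unfolding sinN q(3) by (simp add: algebra_simps flip: exp_add)
      moreover have "N n + q n > 0" using N[of n] q(1)[of n] by simp
      ultimately show ?thesis
        by (simp only: G_def D0 comp_def \<gamma> add.assoc flip: scaleR_add_right) (simp add: eu)
    qed
    moreover have "G (N n - r n) = f (x + exp (- 3 * (N n - r n)) *\<^sub>R w)"
    proof -
      have "exp (- (N n - r n)) * sin (N n - r n) = - exp (- 3 * (N n - r n))"
        unfolding sinN r(3) by (simp add: algebra_simps flip: exp_add)
      moreover have "N n - r n > 0" using N[of n] r(2)[of n] by simp
      ultimately show ?thesis
        by (simp only: G_def D0 comp_def \<gamma> add.assoc scaleR_minus_left)
          (simp add: eu flip: scaleR_diff_right)
    qed
    moreover have "G (N n) = f (x + E *\<^sub>R e)"
      using \<gamma>[of "N n"] N[of n] sinN(1)[of n 0] by (simp add: G_def D0 E_def)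
    moreover have "exp (- 3 * (N n + q n)) = E * exp (- 3 * q n)" "exp (- 3 * (N n - r n)) = E * exp (3 * r n)"
      by (simp_all add: E_def algebra_simps flip: exp_add)
    ultimately have G: "G (N n + q n) - f x = E * exp (- 3 * q n) * P n"
      "G (N n - r n) - f x = E * exp (3 * r n) * Q n" "G (N n) - f x = E * R n"
      using E by (simp_all add: P_def Q_def R_def E')
    have "\<bar>(G (N n + q n) - G (N n)) / q n - (G (N n) - G (N n - r n)) / r n\<bar> \<le> M * (q n + r n)"
      by (rule second_difference_bound[of _ _ _ G G' G''])
        (use N[of n] q(1,2)[of n] r(1,2)[of n] in \<open>auto intro!: \<open>\<And>s. 1 \<le> s \<Longrightarrow> (G has_real_derivative G' s) (at s)\<close> G' G''\<close>)
    also have "(G (N n + q n) - G (N n)) / q n - (G (N n) - G (N n - r n)) / r n = E / q n * Y n"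
    proof -
      have G_eqs: "G (N n + q n) - G (N n) = E * (exp (- 3 * q n) * P n - R n)"
        "G (N n) - G (N n - r n) = E * (R n - exp (3 * r n) * Q n)"
        using G by (simp_all add: algebra_simps)
      show ?thesis
        unfolding G_eqs Y_def using q(1)[of n] r(1)[of n] by (simp add: field_simps)
    qed
    finally have "\<bar>Y n\<bar> \<le> M * (q n + r n) * q n / E"
      using E q(1)[of n] by (simp add: abs_mult field_simps)
    also have "\<dots> \<le> M * (4 * exp 2 * exp (- (2 * N n))) * (2 * exp 2 * exp (- (2 * N n))) / E"
      using M0 E q_le[of n] r_le[of n] q(1)[of n] r(1)[of n]
      by (intro divide_right_mono mult_mono) auto
    also have "\<dots> = M * 8 * (exp 2 * exp 2) * (exp (- (2 * N n)) * exp (- (2 * N n)) / E)"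
      by (simp add: mult_ac)
    also have "\<dots> = M * 8 * exp 4 * exp (- N n)"
      by (simp add: E_def flip: exp_add exp_diff)
    finally show ?thesis .
  qed
  moreover have "(\<lambda>n. M * 8 * exp 4 * exp (- N n)) \<longlonglongrightarrow> 0"
    using tendsto_mult_right_zero[OF exp_lim[of 1]] by simp
  ultimately have "Y \<longlonglongrightarrow> 0"
    by (intro Lim_null_comparison[of Y]) auto
  with Y1 have "a + b - c = 0" by (rule LIMSEQ_unique)
  then show ?thesis by simp
qed

text \<open>The derivative is taken in the norm of the target; for smooth maps into D(A_0^infinity)
  it is shown below to be the limit in D(A^infinity) as well.\<close>

definition dir_vec_deriv :: "('b::real_normed_vector \<Rightarrow> 'a::real_normed_vector) \<Rightarrow> 'b \<Rightarrow> 'b \<Rightarrow> 'a" where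
  "dir_vec_deriv f y v = vector_derivative (\<lambda>t. f (y + t *\<^sub>R v)) (at 0)"

lemma smooth_curve_line:
  fixes y v :: "'b::real_normed_vector"
  shows "smooth_curve euclidean (\<lambda>t. y + t *\<^sub>R v)"
proof -
  define D where "D n t = (if n = 0 then y + t *\<^sub>R v else if n = 1 then v else 0)" for n :: nat and t
  have "(D n has_vector_derivative D (Suc n) t) (at t)" for n t
    by (auto simp: D_def [abs_def] intro!: derivative_eq_intros)
  then show ?thesis unfolding smooth_curve_euclidean_iff
    by (intro exI[of _ D]) (auto simp: D_def)
qed

subsection \<open>The generator on its smooth domain\<close>

lemma openin_seminorm_ball: "h \<in> E \<Longrightarrow> openin (seminorm_topology E p) {g \<in> E. p n (g - h) < r}"
  unfolding seminorm_topology_def by (intro topology_generated_by_Basis) blast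

lemma limitin_seminorm_topologyD:
  assumes "limitin (seminorm_topology E p) f l F" and "p n 0 = 0" and "\<epsilon> > 0"
  shows "\<forall>\<^sub>F x in F. f x \<in> E \<and> p n (f x - l) < \<epsilon>"
proof -
  have l: "l \<in> E" using assms(1) by (simp add: limitin_def)
  then have "openin (seminorm_topology E p) {g \<in> E. p n (g - l) < \<epsilon>}"
    by (rule openin_seminorm_ball)
  moreover have "l \<in> {g \<in> E. p n (g - l) < \<epsilon>}" using l assms by simp
  ultimately have "\<forall>\<^sub>F x in F. f x \<in> {g \<in> E. p n (g - l) < \<epsilon>}"
    using assms(1) unfolding limitin_def by blast
  then show ?thesis by simp
qed

text \<open>Induction over the generation of open sets from the subbasis. Subbasic balls have
  arbitrary centres h, and the triangle inequality transfers closeness to l into membership in such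
  a ball.\<close>

lemma limitin_seminorm_topologyI:
  assumes l: "l \<in> E"
    and ev: "\<And>n \<epsilon>. \<epsilon> > 0 \<Longrightarrow> \<forall>\<^sub>F x in F. f x \<in> E \<and> p n (f x - l) < \<epsilon>"
    and tri: "\<And>n x h. x \<in> E \<Longrightarrow> h \<in> E \<Longrightarrow> p n (x - h) \<le> p n (x - l) + p n (l - h)"
  shows "limitin (seminorm_topology E p) f l F"
proof -
  have "\<forall>\<^sub>F x in F. f x \<in> U"
    if "generate_topology_on {{g \<in> E. p n (g - h) < r} |n h r. h \<in> E} U" "l \<in> U" for U
    using that
  proof (induction rule: generate_topology_on.induct)
    case (Int a b)
    then show ?case by (simp add: eventually_conj)
  next
    case (UN K)
    then obtain k where "k \<in> K" "l \<in> k" by blast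
    with UN show ?case by (blast intro: eventually_mono)
  next
    case (Basis s)
    then obtain n h r where s: "s = {g \<in> E. p n (g - h) < r}" "h \<in> E" by blast
    with Basis have "r - p n (l - h) > 0" by simp
    from ev[OF this, of n] show ?case
      by (rule eventually_mono) (use s tri[of _ h n] in force)
  qed auto
  then have "\<forall>\<^sub>F x in F. f x \<in> U" if "openin (seminorm_topology E p) U" "l \<in> U" for U
    using that unfolding seminorm_topology_def openin_topology_generated_by_iff by blast
  with l show ?thesis
    unfolding limitin_def topspace_seminorm_topology by blast
qed

lemma Cauchy_halving:
  fixes a :: "nat \<Rightarrow> 'a::real_normed_vector"
  assumes "\<And>j. norm (a (Suc j) - a j) \<le> c * (1 / 2) ^ j"
  shows "Cauchy a" and "norm (a n - a 0) \<le> 2 * c"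
proof -
  have c: "c \<ge> 0" using order_trans[OF norm_ge_zero assms[of 0]] by simp
  have *: "norm (a (m + k) - a m) \<le> 2 * c * ((1 / 2) ^ m - (1 / 2) ^ (m + k))" for m k
  proof (induction k)
    case (Suc k)
    have "norm (a (m + Suc k) - a m) \<le> norm (a (Suc (m + k)) - a (m + k)) + norm (a (m + k) - a m)"
      using norm_triangle_ineq[of "a (Suc (m + k)) - a (m + k)" "a (m + k) - a m"] by simp
    with Suc assms[of "m + k"] show ?case by (simp add: algebra_simps)
  qed simp
  have le: "norm (a (m + k) - a m) \<le> 2 * c * (1 / 2) ^ m" for m k
  proof -
    have "2 * c * ((1 / 2) ^ m - (1 / 2) ^ (m + k)) \<le> 2 * c * (1 / 2) ^ m"
      using c by (intro mult_left_mono) auto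
    with * show ?thesis by (rule order_trans)
  qed
  show "norm (a n - a 0) \<le> 2 * c" using le[of 0 n] by simp
  have lim: "(\<lambda>m. 2 * c * (1 / 2) ^ m) \<longlonglongrightarrow> 0"
    by (intro tendsto_mult_right_zero LIMSEQ_realpow_zero) auto
  show "Cauchy a"
  proof (rule metric_CauchyI)
    fix e :: real assume "e > 0"
    then obtain M where M: "2 * c * (1 / 2) ^ m < e" if "m \<ge> M" for m
      using order_tendstoD(2)[OF lim] unfolding eventually_sequentially by blast
    have *: "dist (a m) (a n) < e" if "M \<le> m" "m \<le> n" for m n
      using le[of m "n - m"] M[OF that(1)] that(2) by (simp add: dist_norm norm_minus_commute)
    show "\<exists>M. \<forall>m\<ge>M. \<forall>n\<ge>M. dist (a m) (a n) < e" using * by (metis dist_commute nle_le)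
  qed
qed

text \<open>
  The Henstock--Kurzweil integral is developed for Banach spaces, but the sort of a complete inner
  product space does not entail \<open>banach\<close>. A pair type does have the right arity, so integrals
  are taken in the product with a dummy second component.
\<close>

instance prod :: ("{real_normed_vector, complete_space}", "{real_normed_vector, complete_space}") banach ..

context forward_curve_space
begin

abbreviation "A \<equiv> generator T"
abbreviation "Dom \<equiv> generator_dom T"
abbreviation "Dinf \<equiv> topspace (DAinf T)"

lemma ev_simps:
  assumes "x \<ge> 0"
  shows "ev (f + g) x = ev f x + ev g x" "ev (f - g) x = ev f x - ev g x" "ev (c *\<^sub>R f) x = c * ev f x"
proof -
  have lin: "linear (\<lambda>h. ev h x)" by (rule bounded_linear.linear[OF ev_bounded_linear[OF assms]])
  show "ev (f + g) x = ev f x + ev g x" "ev (f - g) x = ev f x - ev g x" "ev (c *\<^sub>R f) x = c * ev f x"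
    using linear_add[OF lin] linear_diff[OF lin] linear_scale[OF lin, of c] by auto
qed

text \<open>This reduces statements about the generator to derivatives of real functions on the
  half-line. The value is unique also at the boundary point 0, because one-sided derivatives there
  are unique.\<close>

lemma generatorI:
  assumes "\<And>x. x \<ge> 0 \<Longrightarrow> (ev h has_real_derivative ev g x) (at x within {0..})"
  shows "h \<in> Dom" "A h = g"
proof -
  show h: "h \<in> Dom" using assms by (auto simp: generator_dom_eq)
  show "A h = g"
  proof (rule ev_inj)
    fix x :: real assume x: "x \<ge> 0"
    have "at x within {0..} \<noteq> bot"
      using x at_le[of "{x..}" "{0..}" x] by (auto simp: at_within_Ici_at_right bot_unique)
    then show "ev (A h) x = ev g x"
      using has_field_derivative_unique generator_eq[OF h x] assms[OF x] by blast
  qed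
qed

lemma generator_linear:
  assumes "f \<in> Dom" "g \<in> Dom"
  shows "f + g \<in> Dom" "A (f + g) = A f + A g" "c *\<^sub>R f \<in> Dom" "A (c *\<^sub>R f) = c *\<^sub>R A f"
proof -
  have "(ev (f + g) has_real_derivative ev (A f + A g) x) (at x within {0..})" if "x \<ge> 0" for x
  proof (rule has_field_derivative_transform_within[of "\<lambda>x. ev f x + ev g x" _ _ _ 1])
    show "((\<lambda>x. ev f x + ev g x) has_real_derivative ev (A f + A g) x) (at x within {0..})"
      using that assms by (auto intro!: derivative_eq_intros generator_eq simp: ev_simps)
  qed (use that in \<open>auto simp: ev_simps\<close>)
  from generatorI[OF this] show "f + g \<in> Dom" "A (f + g) = A f + A g" by auto
  have "(ev (c *\<^sub>R f) has_real_derivative ev (c *\<^sub>R A f) x) (at x within {0..})" if "x \<ge> 0" for x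
  proof (rule has_field_derivative_transform_within[of "\<lambda>x. c * ev f x" _ _ _ 1])
    show "((\<lambda>x. c * ev f x) has_real_derivative ev (c *\<^sub>R A f) x) (at x within {0..})"
      using that assms DERIV_cmult[OF generator_eq[OF assms(1) that], of c] by (simp add: ev_simps)
  qed (use that in \<open>auto simp: ev_simps\<close>)
  from generatorI[OF this] show "c *\<^sub>R f \<in> Dom" "A (c *\<^sub>R f) = c *\<^sub>R A f" by auto
qed

lemma zero_in_dom: "0 \<in> Dom"
proof -
  have "(ev 0 has_real_derivative ev 0 x) (at x within {0..})" if "x \<ge> 0" for x
    by (rule has_field_derivative_transform_within[of "\<lambda>x. 0" _ _ _ 1])
      (use that ev_simps(2)[of _ 0 0] in auto)
  then show ?thesis by (rule generatorI)
qed

lemma Dinf_eq: "Dinf = (\<Inter>n. power_dom UNIV Dom A n)"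
  by (simp add: DAinf_def smooth_domain_def)

lemma DinfD: "h \<in> Dinf \<Longrightarrow> h \<in> Dom" "h \<in> Dinf \<Longrightarrow> A h \<in> Dinf"
proof -
  assume h: "h \<in> Dinf"
  then have "h \<in> power_dom UNIV Dom A (Suc n)" for n unfolding Dinf_eq by blast
  then show "h \<in> Dom" "A h \<in> Dinf" by (auto simp: Dinf_eq)
qed

lemma subspace_Dinf: "subspace Dinf"
proof -
  have "subspace (power_dom UNIV Dom A n)" for n
  proof (induction n)
    case (Suc n)
    then show ?case
      using zero_in_dom generator_linear(4)[of 0 0 0] generator_linear
      by (auto simp: subspace_def)
  qed simp
  then show ?thesis unfolding Dinf_eq by (intro subspace_Inter) auto
qed

lemma generator_Dinf_diff: "f \<in> Dinf \<Longrightarrow> g \<in> Dinf \<Longrightarrow> A (f - g) = A f - A g"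
  using generator_linear(2)[of "f - g" g] DinfD subspace_diff[OF subspace_Dinf] by fastforce

lemma generator_pow_Dinf:
  assumes "f \<in> Dinf"
  shows "(A ^^ m) f \<in> Dinf" "g \<in> Dinf \<Longrightarrow> (A ^^ m) (f + g) = (A ^^ m) f + (A ^^ m) g"
    "(A ^^ m) (c *\<^sub>R f) = c *\<^sub>R (A ^^ m) f"
proof -
  have D: "(A ^^ m) f \<in> Dinf" if "f \<in> Dinf" for f m
    using that by (induction m) (auto dest: DinfD)
  with assms show "(A ^^ m) f \<in> Dinf" by blast
  show "(A ^^ m) (f + g) = (A ^^ m) f + (A ^^ m) g" if "g \<in> Dinf"
    using generator_linear(2)[OF DinfD(1)[OF D] DinfD(1)[OF D]] assms that by (induction m) auto
  show "(A ^^ m) (c *\<^sub>R f) = c *\<^sub>R (A ^^ m) f"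
    using generator_linear(4)[OF DinfD(1)[OF D] DinfD(1)[OF D]] assms by (induction m) auto
qed

lemma graph_seminorm_Dinf:
  assumes "f \<in> Dinf"
  shows "g \<in> Dinf \<Longrightarrow> graph_seminorm A n (f + g) \<le> graph_seminorm A n f + graph_seminorm A n g"
    "graph_seminorm A n (c *\<^sub>R f) = \<bar>c\<bar> * graph_seminorm A n f"
  by (auto simp: graph_seminorm_def generator_pow_Dinf assms sum_distrib_left norm_triangle_ineq
      simp flip: sum.distrib intro!: sum_mono)

lemma graph_seminorm_zero: "graph_seminorm A n 0 = 0"
  using graph_seminorm_Dinf(2)[OF subspace_0[OF subspace_Dinf], of n 0] by simp

lemma norm_le_graph_seminorm: "norm h \<le> graph_seminorm A n h"
  unfolding graph_seminorm_def using member_le_sum[of 0 "{..n}" "\<lambda>m. norm ((A ^^ m) h)"] by simp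

lemma limitin_DAinfI:
  assumes "l \<in> Dinf" "\<And>n \<epsilon>. \<epsilon> > 0 \<Longrightarrow> \<forall>\<^sub>F x in F. f x \<in> Dinf \<and> graph_seminorm A n (f x - l) < \<epsilon>"
  shows "limitin (DAinf T) f l F"
proof -
  have "graph_seminorm A n (x - h) \<le> graph_seminorm A n (x - l) + graph_seminorm A n (l - h)"
    if "x \<in> Dinf" "h \<in> Dinf" for x h n
    using graph_seminorm_Dinf(1)[of "x - l" "l - h" n] that assms(1)
    by (simp add: subspace_diff[OF subspace_Dinf])
  then show ?thesis using assms
    unfolding DAinf_def smooth_domain_def
    by (intro limitin_seminorm_topologyI) (auto simp: DAinf_def smooth_domain_def)
qed

lemma limitin_DAinf_imp_tendsto:
  assumes "limitin (DAinf T) f l F"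
  shows "(f \<longlongrightarrow> l) F"
proof (rule tendstoI)
  fix \<epsilon> :: real assume "\<epsilon> > 0"
  from limitin_seminorm_topologyD[OF assms[unfolded DAinf_def smooth_domain_def] graph_seminorm_zero this, of 0]
  show "\<forall>\<^sub>F x in F. dist (f x) l < \<epsilon>"
    by (rule eventually_mono) (simp add: graph_seminorm_def dist_norm)
qed

text \<open>Both spaces carry the same graph seminorms, and the domains for A_0 are contained in
  those for A, so the inclusion is continuous.\<close>

lemma limitin_DA0inf_imp:
  assumes "limitin (DA0inf T H0) f l F"
  shows "limitin (DAinf T) f l F"
proof (rule limitin_DAinfI)
  let ?E0 = "\<Inter>n. power_dom H0 {h \<in> Dom \<inter> H0. A h \<in> H0} A n"
  have "power_dom H0 {h \<in> Dom \<inter> H0. A h \<in> H0} A n \<subseteq> power_dom UNIV Dom A n" for n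
    by (induction n) auto
  then have sub: "?E0 \<subseteq> Dinf" unfolding Dinf_eq by blast
  show "l \<in> Dinf"
    using assms sub by (auto simp: limitin_def DA0inf_def smooth_domain_def)
  fix n and \<epsilon> :: real assume "\<epsilon> > 0"
  from limitin_seminorm_topologyD[OF assms[unfolded DA0inf_def smooth_domain_def] graph_seminorm_zero this, of n]
  show "\<forall>\<^sub>F x in F. f x \<in> Dinf \<and> graph_seminorm A n (f x - l) < \<epsilon>"
    by (rule eventually_mono) (use sub in blast)
qed

lemma topspace_DA0inf_subset: "topspace (DA0inf T H0) \<subseteq> Dinf"
proof
  fix h assume "h \<in> topspace (DA0inf T H0)"
  then have "limitin (DA0inf T H0) (\<lambda>_::nat. h) h sequentially" by (simp add: limitin_const)
  from limitin_DA0inf_imp[OF this] show "h \<in> Dinf" by (simp add: limitin_def)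
qed

section \<open>Local boundedness and continuity of the semigroup\<close>

lemma semigroupD:
  "t \<ge> 0 \<Longrightarrow> bounded_linear (T t)" "T 0 h = h" "s \<ge> 0 \<Longrightarrow> t \<ge> 0 \<Longrightarrow> T (s + t) h = T s (T t h)"
  "((\<lambda>t. T t h) \<longlongrightarrow> h) (at_right 0)"
  using semigroup by (auto simp: strongly_continuous_semigroup_def)

lemma T_diff: "t \<ge> 0 \<Longrightarrow> T t (g - h) = T t g - T t h"
  using semigroupD(1) bounded_linear.linear linear_diff by blast

text \<open>Strong continuity bounds each orbit near 0 separately, so the closed sets
  \<open>F n\<close> cover the space and by Baire one of them contains a ball about some x. A
  rescaled vector a h is the difference of x + a h and x, both in \<open>F n\<close>, which yields a
  bound uniform in h.\<close>

lemma semigroup_bounded_near_0: "\<exists>\<delta>>0. \<exists>M\<ge>1. \<forall>t\<in>{0..\<delta>}. \<forall>h. norm (T t h) \<le> M * norm h"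
proof -
  define F where "F n = {h. \<forall>t\<in>{0..1 / real (Suc n)}. norm (T t h) \<le> real (Suc n)}" for n
  have "closed (F n)" for n
  proof -
    have "F n = (\<Inter>t\<in>{0..1 / real (Suc n)}. {h. norm (T t h) \<le> real (Suc n)})"
      by (auto simp: F_def)
    moreover have "closed {h. norm (T t h) \<le> real (Suc n)}" if "t \<in> {0..1 / real (Suc n)}" for t
      using that by (intro closed_Collect_le continuous_on_norm continuous_on_const
          linear_continuous_on semigroupD(1)) auto
    ultimately show ?thesis by (simp add: closed_INT)
  qed
  moreover have "(\<Union>n. F n) = UNIV"
  proof -
    have "\<exists>n. h \<in> F n" for h
    proof -
      have "\<forall>\<^sub>F t in at_right 0. norm (T t h) < norm h + 1"
        using tendsto_norm[OF semigroupD(4)[of h]] by (rule order_tendstoD) simp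
      then obtain b where b: "b > 0" "\<And>t. 0 < t \<Longrightarrow> t < b \<Longrightarrow> norm (T t h) < norm h + 1"
        unfolding eventually_at_right_field by auto
      obtain n1 n2 where n: "1 / b < real n1" "norm h + 1 < real n2"
        using reals_Archimedean2 by meson
      define n where "n = n1 + n2"
      have "1 / b < real (Suc n)" using n(1) by (simp add: n_def)
      then have "1 / real (Suc n) < b" using b(1) by (simp add: field_simps)
      have "norm h + 1 \<le> real (Suc n)" using n(2) by (simp add: n_def)
      have "norm (T t h) \<le> real (Suc n)" if "t \<in> {0..1 / real (Suc n)}" for t
      proof (cases "t = 0")
        case True
        then show ?thesis using \<open>norm h + 1 \<le> real (Suc n)\<close> semigroupD(2)[of h] by simp
      next
        case False
        then have "norm (T t h) < norm h + 1"
          using that \<open>1 / real (Suc n) < b\<close> by (intro b(2)) auto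
        then show ?thesis using \<open>norm h + 1 \<le> real (Suc n)\<close> by simp
      qed
      then show ?thesis unfolding F_def by blast
    qed
    then show ?thesis by blast
  qed
  moreover have "Met_TC.mtopology interior_of \<Union> (range F) = {}" if "\<And>n. interior (F n) = {}"
    using that \<open>\<And>n. closed (F n)\<close>
    by (intro Met_TC.metric_Baire_category_alt) (auto simp: complete_UNIV)
  ultimately have "\<exists>n. interior (F n) \<noteq> {}" by auto
  then obtain n x where "x \<in> interior (F n)" by blast
  then obtain r where r: "r > 0" "ball x r \<subseteq> F n"
    by (auto simp: mem_interior)
  define K where "K = real (Suc n)"
  have K: "K \<ge> 1" by (simp add: K_def)
  have bound: "norm (T t h) \<le> 4 * K / r * norm h" if t: "t \<in> {0..1 / K}" for t h
  proof (cases "h = 0")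
    case True
    then show ?thesis using t linear_0[OF bounded_linear.linear[OF semigroupD(1)]] by simp
  next
    case False
    define a where "a = r / (2 * norm h)"
    have a: "a > 0" using r False by (simp add: a_def)
    have "norm (a *\<^sub>R h) < r" using r False by (simp add: a_def)
    then have "x + a *\<^sub>R h \<in> F n" "x \<in> F n" using r by (auto simp: dist_norm)
    then have "norm (T t (x + a *\<^sub>R h)) \<le> K" "norm (T t x) \<le> K" using t by (auto simp: F_def K_def)
    moreover have "T t (x + a *\<^sub>R h) - T t x = a *\<^sub>R T t h"
      using t linear_scale[OF bounded_linear.linear[OF semigroupD(1)]] by (simp flip: T_diff)
    ultimately have "norm (a *\<^sub>R T t h) \<le> 2 * K"
      using norm_triangle_ineq4[of "T t (x + a *\<^sub>R h)" "T t x"] by simp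
    then have "a * norm (T t h) \<le> 2 * K" using a by simp
    then show ?thesis using a r False by (simp add: a_def field_simps)
  qed
  have "norm (T t h) \<le> max 1 (4 * K / r) * norm h" if t: "t \<in> {0..1 / K}" for t h
    using order_trans[OF bound[OF t] mult_right_mono[of "4 * K / r" "max 1 (4 * K / r)" "norm h"]] by simp
  then show ?thesis using K by (intro exI[of _ "1 / K"] conjI exI[of _ "max 1 (4 * K / r)"]) auto
qed

lemma semigroup_locally_bounded:
  obtains M where "M \<ge> 1" "\<And>t h. 0 \<le> t \<Longrightarrow> t \<le> b \<Longrightarrow> norm (T t h) \<le> M * norm h"
proof -
  obtain \<delta> M where \<delta>: "\<delta> > 0" and M: "M \<ge> 1"
    and TM: "\<And>t h. 0 \<le> t \<Longrightarrow> t \<le> \<delta> \<Longrightarrow> norm (T t h) \<le> M * norm h"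
    using semigroup_bounded_near_0 by (metis atLeastAtMost_iff)
  have *: "norm (T t h) \<le> M ^ Suc n * norm h" if "0 \<le> t" "t \<le> real (Suc n) * \<delta>" for n t h
    using that
  proof (induction n arbitrary: t)
    case 0
    then show ?case using TM[of t h] by simp
  next
    case (Suc n)
    show ?case
    proof (cases "t \<le> real (Suc n) * \<delta>")
      case True
      have "norm (T t h) \<le> M ^ Suc n * norm h" using Suc True by blast
      also have "\<dots> \<le> M ^ Suc (Suc n) * norm h"
        using M by (intro mult_right_mono power_increasing) auto
      finally show ?thesis .
    next
      case False
      have n0: "\<delta> \<le> real (Suc n) * \<delta>" using \<delta> by simp
      have t: "0 \<le> t - \<delta>" "t - \<delta> \<le> real (Suc n) * \<delta>"
        using Suc.prems False n0 by (linarith, simp add: algebra_simps)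
      have "norm (T (\<delta> + (t - \<delta>)) h) \<le> M * norm (T (t - \<delta>) h)"
        using TM[of \<delta> "T (t - \<delta>) h"] \<delta> t(1) semigroupD(3)[of \<delta> "t - \<delta>" h] by simp
      also have "\<dots> \<le> M * (M ^ Suc n * norm h)"
        using Suc.IH[OF t] M by (intro mult_left_mono) auto
      finally show ?thesis by (simp add: mult.assoc)
    qed
  qed
  obtain n where "b / \<delta> < real n" using reals_Archimedean2 by blast
  then have "b \<le> real (Suc n) * \<delta>" using \<delta> by (simp add: field_simps)
  then show thesis
    using *[of _ n] one_le_power[OF M, of "Suc n"] by (intro that[of "M ^ Suc n"]) auto
qed

text \<open>Continuity is given only at 0 from the right. For p \<le> q the increment is T p applied
  to T (q - p) h - h, and the uniform bound on T p gives continuity from both sides.\<close>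

lemma continuous_on_orbit: "continuous_on {0..b} (\<lambda>s. T s h)"
proof -
  obtain M where M: "M \<ge> 1" "\<And>t h. 0 \<le> t \<Longrightarrow> t \<le> b \<Longrightarrow> norm (T t h) \<le> M * norm h"
    using semigroup_locally_bounded by blast
  show ?thesis unfolding continuous_on_iff
  proof (intro ballI allI impI)
    fix s and \<epsilon> :: real assume s: "s \<in> {0..b}" and "\<epsilon> > 0"
    then have "\<epsilon> / M > 0" using M by simp
    then have "\<forall>\<^sub>F t in at_right 0. dist (T t h) h < \<epsilon> / M"
      using semigroupD(4) tendstoD by blast
    then obtain d where d: "d > 0" "\<And>t. 0 < t \<Longrightarrow> t < d \<Longrightarrow> dist (T t h) h < \<epsilon> / M"
      unfolding eventually_at_right_field by auto
    have *: "dist (T q h) (T p h) < \<epsilon>" if "0 \<le> p" "p \<le> q" "q \<le> b" "q - p < d" for p q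
    proof (cases "p = q")
      case False
      have "T q h - T p h = T p (T (q - p) h - h)"
        using that semigroupD(3)[of p "q - p" h] by (simp add: T_diff)
      then have "norm (T q h - T p h) \<le> M * norm (T (q - p) h - h)"
        using M(2)[of p] that by simp
      also have "\<dots> < M * (\<epsilon> / M)"
        using d(2)[of "q - p"] that False M(1) by (intro mult_strict_left_mono) (auto simp: dist_norm)
      finally show ?thesis using M by (simp add: dist_norm)
    qed (use \<open>\<epsilon> > 0\<close> in simp)
    have "dist (T s' h) (T s h) < \<epsilon>" if "s' \<in> {0..b}" "dist s' s < d" for s'
      using *[of s s'] *[of s' s] that s by (cases "s \<le> s'") (auto simp: dist_real_def dist_commute)
    then show "\<exists>d>0. \<forall>x'\<in>{0..b}. dist x' s < d \<longrightarrow> dist (T x' h) (T s h) < \<epsilon>"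
      using d(1) by blast
  qed
qed

section \<open>Averages of orbits\<close>

text \<open>The mean of the orbit over [0, t] acts as a mollifier: it lies in D(A), tends to h as t
  tends to 0, and commutes with A on D(A).\<close>

definition avg :: "real \<Rightarrow> 'h \<Rightarrow> 'h" where
  "avg t h = (1 / t) *\<^sub>R fst (integral {0..t} (\<lambda>s. (T s h, 0::'h)))"

lemma orbit_integrable: "(\<lambda>s. (T s h, 0::'h)) integrable_on {0..t}"
  by (intro integrable_continuous_real continuous_on_Pair continuous_on_orbit continuous_on_const)

lemma avg_near:
  assumes t: "t > 0" and c: "\<And>s. 0 \<le> s \<Longrightarrow> s \<le> t \<Longrightarrow> norm (T s h - g) \<le> c"
  shows "norm (avg t h - g) \<le> c"
proof -
  define J where "J = integral {0..t} (\<lambda>s. (T s h, 0::'h) - (g, 0))"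
  have "norm J \<le> c * (t - 0)"
    unfolding J_def using t
    by (intro integral_bound continuous_on_diff continuous_on_Pair continuous_on_orbit continuous_on_const)
      (auto simp: c)
  with norm_fst_le[of "fst J" "snd J"] have "norm (fst J) \<le> c * t" by simp
  moreover have "J = integral {0..t} (\<lambda>s. (T s h, 0::'h)) - integral {0..t} (\<lambda>s. (g, 0))"
    unfolding J_def by (rule integral_diff[OF orbit_integrable]) (rule integrable_const_ivl)
  then have "fst J = t *\<^sub>R (avg t h - g)"
    using t by (simp add: avg_def scaleR_diff_right)
  ultimately show ?thesis using t by (simp add: mult.commute)
qed

text \<open>Evaluation is bounded and linear, so it passes under the integral; identities for
  averages thereby become the fundamental theorem of calculus.\<close>

lemma ev_avg:
  assumes t: "t > 0" and x: "x \<ge> 0"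
  shows "ev (avg t h) x = (1 / t) * integral {0..t} (\<lambda>s. ev h (s + x))"
proof -
  have "bounded_linear ((\<lambda>h. ev h x) \<circ> (fst :: 'h \<times> 'h \<Rightarrow> 'h))"
    unfolding o_def by (rule bounded_linear_compose[OF ev_bounded_linear[OF x] bounded_linear_fst])
  from integral_linear[OF orbit_integrable this, of t h]
  have "ev (fst (integral {0..t} (\<lambda>s. (T s h, 0::'h)))) x = integral {0..t} (\<lambda>s. ev (T s h) x)"
    by (simp add: o_def)
  also have "\<dots> = integral {0..t} (\<lambda>s. ev h (s + x))"
    by (rule integral_cong) (use x shift in auto)
  finally show ?thesis using x by (simp add: avg_def ev_simps)
qed

lemma integral_shifted_derivative:
  assumes F: "\<And>x. x \<ge> 0 \<Longrightarrow> (F has_real_derivative f x) (at x within {0..})"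
    and "t \<ge> 0" "x \<ge> 0"
  shows "integral {0..t} (\<lambda>s. f (s + x)) = F (t + x) - F x"
proof -
  have "((\<lambda>s. F (s + x)) has_real_derivative f (s + x)) (at s within {0..t})" if "s \<in> {0..t}" for s
  proof -
    have 1: "(F has_real_derivative f (s + x)) (at (s + x) within (\<lambda>s. s + x) ` {0..t})"
      by (rule has_field_derivative_subset[OF F]) (use that assms in auto)
    have 2: "((\<lambda>s. s + x) has_real_derivative 1) (at s within {0..t})"
      by (auto intro!: derivative_eq_intros)
    from DERIV_image_chain[OF 1 2] show ?thesis by (simp add: o_def)
  qed
  then have "((\<lambda>s. f (s + x)) has_integral F (t + x) - F (0 + x)) {0..t}"
    using assms by (intro fundamental_theorem_of_calculus)
      (auto simp flip: has_real_derivative_iff_has_vector_derivative)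
  then show ?thesis by (simp add: integral_unique)
qed

lemma avg_generator:
  assumes "t > 0" "h \<in> Dom"
  shows "avg t (A h) = (1 / t) *\<^sub>R (T t h - h)"
proof (rule ev_inj)
  fix x :: real assume x: "x \<ge> 0"
  show "ev (avg t (A h)) x = ev ((1 / t) *\<^sub>R (T t h - h)) x"
    using integral_shifted_derivative[OF generator_eq[OF assms(2)], of t x] assms x
    by (simp add: ev_avg ev_simps shift)
qed

text \<open>If F is a primitive of \<open>ev h\<close>, the average is x \<mapsto> (F(t + x) - F(x))
  / t, whose derivative is the difference quotient of the shift.\<close>

lemma generator_avg:
  assumes t: "t > 0"
  shows "avg t h \<in> Dom" "A (avg t h) = (1 / t) *\<^sub>R (T t h - h)"
proof -
  define F where "F x = integral {0..x} (ev h)" for x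
  have F: "(F has_real_derivative ev h x) (at x within {0..})" if x: "x \<ge> 0" for x
  proof -
    have "(F has_real_derivative ev h x) (at x within {0..x + 1})"
      unfolding F_def [abs_def]
      by (intro integral_has_real_derivative continuous_on_subset[OF ev_continuous]) (use x in auto)
    moreover have "at x within {0..x + 1} = at x within {0..}"
      by (rule at_within_nhd[of _ "{..<x + 1}"]) auto
    ultimately show ?thesis by simp
  qed
  have avgF: "ev (avg t h) x = (1 / t) * (F (t + x) - F x)" if "x \<ge> 0" for x
    using integral_shifted_derivative[OF F, of t x] t that by (simp add: ev_avg)
  have "(ev (avg t h) has_real_derivative ev ((1 / t) *\<^sub>R (T t h - h)) x) (at x within {0..})"
    if x: "x \<ge> 0" for x
  proof (rule has_field_derivative_transform_within[of "\<lambda>x. (1 / t) * (F (t + x) - F x)" _ _ _ 1])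
    have 1: "(F has_real_derivative ev h (t + x)) (at (t + x) within (\<lambda>x. t + x) ` {0..})"
      by (rule has_field_derivative_subset[OF F]) (use t x in auto)
    have 2: "((\<lambda>x. t + x) has_real_derivative 1) (at x within {0..})"
      by (auto intro!: derivative_eq_intros)
    from DERIV_image_chain[OF 1 2]
    have "((\<lambda>x. F (t + x)) has_real_derivative ev h (t + x)) (at x within {0..})"
      by (simp add: o_def)
    from DERIV_cmult[OF DERIV_diff[OF this F[OF x]], of "1 / t"]
    show "((\<lambda>x. (1 / t) * (F (t + x) - F x)) has_real_derivative ev ((1 / t) *\<^sub>R (T t h - h)) x)
        (at x within {0..})"
      using t x by (simp add: ev_simps shift)
  qed (use x avgF in auto)
  from generatorI[OF this] show "avg t h \<in> Dom" "A (avg t h) = (1 / t) *\<^sub>R (T t h - h)" by auto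
qed

lemma avg_diff: "avg t (g - h) = avg t g - avg t h"
proof -
  have "integral {0..t} (\<lambda>s. (T s (g - h), 0::'h)) = integral {0..t} (\<lambda>s. (T s g, 0) - (T s h, 0))"
    by (rule integral_cong) (simp add: T_diff)
  also have "\<dots> = integral {0..t} (\<lambda>s. (T s g, 0)) - integral {0..t} (\<lambda>s. (T s h, 0))"
    by (rule integral_diff[OF orbit_integrable orbit_integrable])
  finally show ?thesis by (simp add: avg_def scaleR_diff_right)
qed

lemma avg_bound:
  assumes "0 < t" "t \<le> b" "\<And>s h. 0 \<le> s \<Longrightarrow> s \<le> b \<Longrightarrow> norm (T s h) \<le> M * norm h"
  shows "norm (avg t h) \<le> M * norm h"
  using avg_near[of t h 0 "M * norm h"] assms by simp

lemma avg_tendsto: "((\<lambda>t. avg t h) \<longlongrightarrow> h) (at_right 0)"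
proof (rule tendstoI)
  fix \<epsilon> :: real assume "\<epsilon> > 0"
  then have "\<forall>\<^sub>F t in at_right 0. dist (T t h) h < \<epsilon> / 2"
    by (intro tendstoD[OF semigroupD(4)]) simp
  then obtain d where d: "d > 0" "\<And>t. 0 < t \<Longrightarrow> t < d \<Longrightarrow> dist (T t h) h < \<epsilon> / 2"
    unfolding eventually_at_right_field by auto
  have "dist (avg t h) h < \<epsilon>" if t: "0 < t" "t < d" for t
  proof -
    have "norm (T s h - h) \<le> \<epsilon> / 2" if "0 \<le> s" "s \<le> t" for s
      using d(2)[of s] that t \<open>\<epsilon> > 0\<close> semigroupD(2)[of h] by (cases "s = 0") (auto simp: dist_norm)
    from avg_near[OF t(1) this] show ?thesis using \<open>\<epsilon> > 0\<close> by (simp add: dist_norm)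
  qed
  then show "\<forall>\<^sub>F t in at_right 0. dist (avg t h) h < \<epsilon>"
    unfolding eventually_at_right_field using d(1) by blast
qed

text \<open>The identity (T t h - h) / t = avg t (A h) passes to the limit because
  \<open>avg t\<close> is bounded; then t tends to 0.\<close>

lemma generator_closed:
  assumes h: "h \<longlonglongrightarrow> x" and Ah: "(\<lambda>n. A (h n)) \<longlonglongrightarrow> g" and D: "\<And>n. h n \<in> Dom"
  shows "x \<in> Dom"
proof -
  have "(T t x - x) /\<^sub>R t = avg t g" if t: "t > 0" for t
  proof (rule LIMSEQ_unique)
    obtain M where M: "M \<ge> 1" "\<And>s h. 0 \<le> s \<Longrightarrow> s \<le> t \<Longrightarrow> norm (T s h) \<le> M * norm h"
      using semigroup_locally_bounded by blast
    have "(\<lambda>n. M * norm (A (h n) - g)) \<longlonglongrightarrow> 0"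
      using Ah by (intro tendsto_mult_right_zero tendsto_norm_zero) (simp add: LIM_zero_iff)
    then have "(\<lambda>n. avg t (A (h n)) - avg t g) \<longlonglongrightarrow> 0"
      by (rule Lim_null_comparison[rotated]) (use avg_bound[OF t order_refl M(2)] t in \<open>simp add: avg_diff[symmetric]\<close>)
    then show "(\<lambda>n. avg t (A (h n))) \<longlonglongrightarrow> avg t g" by (simp add: LIM_zero_iff)
    have "(\<lambda>n. (1 / t) *\<^sub>R (T t (h n) - h n)) \<longlonglongrightarrow> (1 / t) *\<^sub>R (T t x - x)"
      using t by (intro tendsto_intros h bounded_linear.tendsto[OF semigroupD(1)]) auto
    then show "(\<lambda>n. avg t (A (h n))) \<longlonglongrightarrow> (T t x - x) /\<^sub>R t"
      using t D by (simp add: avg_generator divide_inverse)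
  qed
  then have "\<forall>\<^sub>F t in at_right 0. avg t g = (T t x - x) /\<^sub>R t"
    by (auto simp: eventually_at_filter)
  from Lim_transform_eventually[OF avg_tendsto this] show ?thesis
    by (auto simp: generator_dom_def)
qed

lemma generator_avg_commute: "t > 0 \<Longrightarrow> h \<in> Dom \<Longrightarrow> A (avg t h) = avg t (A h)"
  by (simp add: generator_avg avg_generator)

lemma power_dom_avg: "t > 0 \<Longrightarrow> h \<in> power_dom UNIV Dom A n \<Longrightarrow> avg t h \<in> power_dom UNIV Dom A (Suc n)"
proof (induction n arbitrary: h)
  case (Suc n)
  then have "avg t (A h) \<in> power_dom UNIV Dom A (Suc n)" by simp
  with Suc.prems show ?case
    using generator_avg(1)[of t h] generator_avg_commute[of t h] by simp
qed (simp add: generator_avg)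

text \<open>
  The approximant is an infinite composition \<open>avg \<tau>\<^sub>0 (avg \<tau>\<^sub>1 (\<dots> h))\<close> of averages with rapidly
  decreasing lengths. Each of its tails is the average of the next one, and one average gains one
  derivative.
\<close>

lemma Dinf_dense:
  assumes "\<epsilon> > 0"
  shows "\<exists>g\<in>Dinf. norm (g - h) \<le> \<epsilon>"
proof -
  obtain M where M: "M \<ge> 1" and TM: "\<And>t h. 0 \<le> t \<Longrightarrow> t \<le> 1 \<Longrightarrow> norm (T t h) \<le> M * norm h"
    using semigroup_locally_bounded[of 1] by blast
  \<comment> \<open>The error made at position n passes through at most n further averages, each of
    norm at most M; the factor M^n compensates for this, and the remaining terms sum to
    \<epsilon>.\<close>
  have "\<exists>t. 0 < t \<and> t \<le> 1 \<and> norm (avg t h - h) \<le> \<epsilon> / 2 * (1 / 2) ^ n / M ^ n" for n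
  proof -
    have "\<epsilon> / 2 * (1 / 2) ^ n / M ^ n > 0" using assms M by simp
    from tendstoD[OF avg_tendsto this]
    have "\<forall>\<^sub>F t in at_right 0. dist (avg t h) h < \<epsilon> / 2 * (1 / 2) ^ n / M ^ n" .
    moreover have "\<forall>\<^sub>F t in at_right 0. 0 < t \<and> t \<le> (1::real)"
      unfolding eventually_at_right_field by (auto intro!: exI[of _ 1])
    ultimately have "\<forall>\<^sub>F t in at_right 0. 0 < t \<and> t \<le> 1 \<and> norm (avg t h - h) \<le> \<epsilon> / 2 * (1 / 2) ^ n / M ^ n"
      by eventually_elim (auto simp: dist_norm)
    from eventually_happens'[OF trivial_limit_at_right_real this] show ?thesis .
  qed
  then have "\<forall>n. \<exists>t. 0 < t \<and> t \<le> 1 \<and> norm (avg t h - h) \<le> \<epsilon> / 2 * (1 / 2) ^ n / M ^ n" by blast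
  from choice[OF this] obtain \<tau> where \<tau>: "\<And>n. 0 < \<tau> n" "\<And>n. \<tau> n \<le> 1"
    "\<And>n. norm (avg (\<tau> n) h - h) \<le> \<epsilon> / 2 * (1 / 2) ^ n / M ^ n"
    by blast
  have avgM: "norm (avg (\<tau> n) x) \<le> M * norm x" for n x
    by (rule avg_bound[OF \<tau>(1) \<tau>(2) TM])
  \<comment> \<open>\<open>C j k\<close> applies j averages, of lengths from \<open>\<tau> k\<close>
    outermost to \<open>\<tau> (k + j - 1)\<close> innermost, to h. The recursion runs over
    functions of k, since a new outermost average shifts the indices of the others.\<close>
  define C where "C = rec_nat (\<lambda>_. h) (\<lambda>j c k. avg (\<tau> k) (c (Suc k)))"
  have C0: "C 0 k = h" and CS: "C (Suc j) k = avg (\<tau> k) (C j (Suc k))" for j k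
    by (simp_all add: C_def)
  have step: "norm (C (Suc j) k - C j k) \<le> M ^ j * norm (avg (\<tau> (k + j)) h - h)" for j k
  proof (induction j arbitrary: k)
    case 0
    then show ?case by (simp add: C0 CS)
  next
    case (Suc j)
    have "norm (C (Suc (Suc j)) k - C (Suc j) k) = norm (avg (\<tau> k) (C (Suc j) (Suc k) - C j (Suc k)))"
      by (simp only: CS[of "Suc j" k] CS[of j k] avg_diff)
    also have "\<dots> \<le> M * norm (C (Suc j) (Suc k) - C j (Suc k))" by (rule avgM)
    also have "\<dots> \<le> M * (M ^ j * norm (avg (\<tau> (Suc k + j)) h - h))"
      using M by (intro mult_left_mono Suc.IH) auto
    finally show ?case by (simp add: mult.assoc)
  qed
  have halving: "norm (C (Suc j) k - C j k) \<le> \<epsilon> / 2 * (1 / 2) ^ j" for j k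
  proof -
    have "M ^ j * norm (avg (\<tau> (k + j)) h - h) \<le> M ^ j * (\<epsilon> / 2 * (1 / 2) ^ (k + j) / M ^ (k + j))"
      using M by (intro mult_left_mono \<tau>(3)) auto
    also have "\<dots> = \<epsilon> / 2 * (1 / 2) ^ j * ((1 / 2) ^ k / M ^ k)"
      using M by (simp add: power_add)
    also have "\<dots> \<le> \<epsilon> / 2 * (1 / 2) ^ j * 1"
    proof (intro mult_left_mono)
      have "(1 / 2) ^ k \<le> (1::real)" by (simp add: power_le_one)
      also have "1 \<le> M ^ k" using M by (rule one_le_power)
      finally show "(1 / 2) ^ k / M ^ k \<le> 1" using M by (simp add: divide_le_eq)
    qed (use assms in simp)
    finally show ?thesis using step[of j k] by simp
  qed
  have "convergent (\<lambda>j. C j k)" for k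
    by (rule Cauchy_convergent) (rule Cauchy_halving(1)[of "\<lambda>j. C j k", OF halving])
  then obtain g where g: "\<And>k. (\<lambda>j. C j k) \<longlonglongrightarrow> g k"
    unfolding convergent_def by metis
  have g_Suc: "g k = avg (\<tau> k) (g (Suc k))" for k
  proof (rule LIMSEQ_unique)
    show "(\<lambda>j. C (Suc j) k) \<longlonglongrightarrow> g k" using g by (rule LIMSEQ_Suc)
    have "(\<lambda>j. M * norm (C j (Suc k) - g (Suc k))) \<longlonglongrightarrow> 0"
      using g[of "Suc k"] by (intro tendsto_mult_right_zero tendsto_norm_zero) (simp add: LIM_zero_iff)
    then have "(\<lambda>j. avg (\<tau> k) (C j (Suc k)) - avg (\<tau> k) (g (Suc k))) \<longlonglongrightarrow> 0"
      by (rule Lim_null_comparison[rotated]) (simp add: avgM flip: avg_diff)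
    then show "(\<lambda>j. C (Suc j) k) \<longlonglongrightarrow> avg (\<tau> k) (g (Suc k))"
      by (simp add: CS LIM_zero_iff)
  qed
  \<comment> \<open>The induction must treat all tails at once: level n + 1 for tail k rests on
    level n for tail k + 1.\<close>
  have "g k \<in> power_dom UNIV Dom A n" for k n
  proof (induction n arbitrary: k)
    case (Suc n)
    then show ?case using power_dom_avg[OF \<tau>(1)] g_Suc by metis
  qed simp
  then have "g 0 \<in> Dinf" unfolding Dinf_eq by blast
  moreover have "norm (g 0 - h) \<le> \<epsilon>"
  proof (rule tendsto_upperbound)
    show "(\<lambda>j. norm (C j 0 - h)) \<longlonglongrightarrow> norm (g 0 - h)" by (intro tendsto_intros g)
    show "\<forall>\<^sub>F j in sequentially. norm (C j 0 - h) \<le> \<epsilon>"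
      using Cauchy_halving(2)[of "\<lambda>j. C j 0", OF halving] by (simp add: C0)
  qed simp
  ultimately show ?thesis by blast
qed

section \<open>From graph-norm bounds to an everywhere defined generator\<close>

text \<open>A Landau-Kolmogorov inequality: the average of A h is a difference quotient of the orbit
  of h, and it differs from A h by at most t M times the norm of A (A h).\<close>

lemma generator_interpolation:
  assumes "h \<in> Dom" "A h \<in> Dom" "0 < t" "t \<le> b"
    and TM: "\<And>s h. 0 \<le> s \<Longrightarrow> s \<le> b \<Longrightarrow> norm (T s h) \<le> M * norm h"
  shows "norm (A h) \<le> (M + 1) / t * norm h + t * M * norm (A (A h))"
proof -
  have M: "M * norm (A (A h)) \<ge> 0"
    using TM[of 0 "A (A h)"] assms norm_ge_zero[of "T 0 (A (A h))"] by linarith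
  have "norm (T s (A h) - A h) \<le> t * M * norm (A (A h))" if s: "0 \<le> s" "s \<le> t" for s
  proof (cases "s = 0")
    case False
    then have "T s (A h) - A h = s *\<^sub>R avg s (A (A h))" using s assms by (simp add: avg_generator)
    moreover have "norm (avg s (A (A h))) \<le> M * norm (A (A h))"
      using s assms False by (intro avg_bound[of s b]) auto
    moreover have "s * norm (avg s (A (A h))) \<le> t * (M * norm (A (A h)))"
      using s calculation(2) by (intro mult_mono) auto
    ultimately show ?thesis using s by (simp add: mult.assoc)
  qed (use M assms in \<open>simp add: semigroupD mult.assoc\<close>)
  from avg_near[OF assms(3) this] have "norm (avg t (A h) - A h) \<le> t * M * norm (A (A h))" by simp
  moreover have "norm (avg t (A h)) \<le> (M + 1) / t * norm h"
  proof -
    have "norm (T t h - h) \<le> (M + 1) * norm h"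
      using norm_triangle_ineq4[of "T t h" h] TM[OF less_imp_le[OF assms(3)] assms(4), of h] by (simp add: algebra_simps)
    then have "norm (T t h - h) / t \<le> (M + 1) * norm h / t"
      using assms by (intro divide_right_mono) auto
    then show ?thesis using assms by (simp add: avg_generator)
  qed
  ultimately show ?thesis
    using norm_triangle_ineq4[of "avg t (A h)" "avg t (A h) - A h"] by simp
qed

lemma bounded_generator_imp_dom_UNIV:
  assumes bound: "\<And>h. h \<in> Dinf \<Longrightarrow> norm (A (A h)) \<le> C * (norm h + norm (A h))"
  shows "Dom = UNIV"
proof -
  obtain M where M: "M \<ge> 1" and TM: "\<And>t h. 0 \<le> t \<Longrightarrow> t \<le> 1 \<Longrightarrow> norm (T t h) \<le> M * norm h"
    using semigroup_locally_bounded[of 1] by blast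
  define C' where "C' = max C 1"
  \<comment> \<open>Then t M C' = 1/2, and the second interpolation term is at most half of norm h +
    norm (A h), so norm (A h) is absorbed. Taking C' at least 1 ensures t \<le> 1.\<close>
  define t where "t = 1 / (2 * M * C')"
  have C': "C' \<ge> 1" "C \<le> C'" by (auto simp: C'_def)
  have MC: "M * C' \<ge> 1" using M C' by (simp add: mult_ge1_I)
  have t: "0 < t" "t \<le> 1" "t * M * C' = 1 / 2"
    using M C' MC by (auto simp: t_def)
  define K where "K = 2 * ((M + 1) / t + 1 / 2)"
  have absorb: "y \<le> 2 * (p + 1 / 2) * n" if "y \<le> p * n + (n + y) / 2" for y p n :: real
  proof -
    have "2 * y \<le> 2 * (p * n) + (n + y)" using that by (simp add: field_simps)
    then have "y \<le> 2 * (p * n) + n" by simp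
    then show ?thesis by (simp add: algebra_simps)
  qed
  have K: "norm (A h) \<le> K * norm h" if h: "h \<in> Dinf" for h
  proof -
    have "norm (A (A h)) \<le> C' * (norm h + norm (A h))"
      using order_trans[OF bound[OF h] mult_right_mono[OF C'(2)]] by simp
    then have "t * M * norm (A (A h)) \<le> t * M * (C' * (norm h + norm (A h)))"
      using t M by (intro mult_left_mono) auto
    also have "\<dots> = (norm h + norm (A h)) / 2"
      using t(3) by (simp add: mult.assoc[symmetric])
    finally have "norm (A h) \<le> (M + 1) / t * norm h + (norm h + norm (A h)) / 2"
      using generator_interpolation[OF DinfD(1)[OF h] DinfD(1)[OF DinfD(2)[OF h]] t(1,2) TM] by linarith
    then show ?thesis unfolding K_def by (rule absorb)
  qed
  have "x \<in> Dom" for x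
  proof -
    have "\<exists>g\<in>Dinf. norm (g - x) \<le> 1 / real (Suc n)" for n by (rule Dinf_dense) simp
    then obtain g where g: "\<And>n. g n \<in> Dinf" "\<And>n. norm (g n - x) \<le> 1 / real (Suc n)" by metis
    have "(\<lambda>n. g n - x) \<longlonglongrightarrow> 0"
      by (rule Lim_null_comparison[OF always_eventually LIMSEQ_Suc[OF lim_1_over_n]]) (use g in auto)
    then have gx: "g \<longlonglongrightarrow> x" by (simp add: LIM_zero_iff)
    have "Cauchy (\<lambda>n. A (g n))"
    proof (rule metric_CauchyI)
      fix e :: real assume e: "e > 0"
      have K0: "\<bar>K\<bar> + 1 > 0" by simp
      obtain N where N: "\<And>m n. m \<ge> N \<Longrightarrow> n \<ge> N \<Longrightarrow> dist (g m) (g n) < e / (\<bar>K\<bar> + 1)"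
        using metric_CauchyD[OF LIMSEQ_imp_Cauchy[OF gx], of "e / (\<bar>K\<bar> + 1)"] e K0 by auto
      have "dist (A (g m)) (A (g n)) < e" if "m \<ge> N" "n \<ge> N" for m n
      proof -
        have "dist (A (g m)) (A (g n)) \<le> K * dist (g m) (g n)"
          using K[OF subspace_diff[OF subspace_Dinf g(1) g(1)], of m n]
          by (simp add: dist_norm generator_Dinf_diff g)
        also have "\<dots> \<le> (\<bar>K\<bar> + 1) * dist (g m) (g n)" by (intro mult_right_mono) auto
        also have "\<dots> < e" using N[OF that] K0 by (simp add: field_simps)
        finally show ?thesis .
      qed
      then show "\<exists>N. \<forall>m\<ge>N. \<forall>n\<ge>N. dist (A (g m)) (A (g n)) < e" by blast
    qed
    then obtain y where "(\<lambda>n. A (g n)) \<longlonglongrightarrow> y"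
      using Cauchy_convergent convergent_def by blast
    from generator_closed[OF gx this] show ?thesis using g DinfD by blast
  qed
  then show ?thesis by blast
qed

lemma openin_graph_ball: "openin (DAinf T) {g \<in> Dinf. graph_seminorm A n g < r}"
  using openin_seminorm_ball[of 0 Dinf "graph_seminorm A" n r] subspace_0[OF subspace_Dinf]
  by (simp add: DAinf_def smooth_domain_def)

text \<open>
  Otherwise \<open>A\<close> would be bounded in the graph norm: with \<open>K\<close> the common kernel of \<open>l\<close> and \<open>l \<circ> A\<close>, on
  \<open>A ` K\<close> because it is finite-dimensional, and modulo \<open>K\<close> because the open map \<open>(l, l \<circ> A)\<close> lifts
  vectors with control of every seminorm. Then \<open>A\<close> is bounded by interpolation, and everywhere defined
  because it is closed and densely defined.
\<close>

lemma generator_kernel_infinite_dimensional: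
  fixes l :: "'h \<Rightarrow> 'b::real_normed_vector"
  assumes l: "bounded_linear l"
    and open_map: "open_map (DAinf T) euclidean (\<lambda>h. (l h, l (A h)))"
    and unbounded: "Dom \<noteq> UNIV" and "finite W"
  shows "\<exists>k\<in>Dinf. l k = 0 \<and> l (A k) = 0 \<and> A k \<notin> span W"
proof (rule ccontr)
  assume neg: "\<not> ?thesis"
  define K where "K = {k \<in> Dinf. l k = 0 \<and> l (A k) = 0}"
  have lin: "linear l" by (rule bounded_linear.linear[OF l])
  have K: "subspace K"
    unfolding subspace_def
  proof (intro conjI ballI allI)
    show "0 \<in> K"
      using generator_linear(4)[OF zero_in_dom zero_in_dom, of 0] subspace_0[OF subspace_Dinf]
      by (simp add: K_def linear_0[OF lin])
    fix x y c assume x: "x \<in> K"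
    then show "c *\<^sub>R x \<in> K"
      using generator_linear(4)[of x x c] subspace_scale[OF subspace_Dinf, of x c]
      by (simp add: K_def DinfD linear_scale[OF lin])
    assume "y \<in> K"
    with x show "x + y \<in> K"
      using generator_linear(2)[of x y] subspace_add[OF subspace_Dinf, of x y]
      by (simp add: K_def DinfD linear_add[OF lin])
  qed
  have AK: "subspace (A ` K)"
  proof -
    have "A x + A y \<in> A ` K" if "x \<in> K" "y \<in> K" for x y
      using that imageI[OF subspace_add[OF K that], of A] generator_linear(2)[of x y] by (simp add: K_def DinfD)
    moreover have "c *\<^sub>R A x \<in> A ` K" if "x \<in> K" for x c
      using that imageI[OF subspace_scale[OF K that, of c], of A] generator_linear(4)[of x x c] by (simp add: K_def DinfD)
    moreover have "0 \<in> A ` K"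
      using subspace_0[OF K] generator_linear(4)[OF zero_in_dom zero_in_dom, of 0] by (auto simp: image_iff)
    ultimately show ?thesis by (auto simp: subspace_def)
  qed
  have AKD: "A ` K \<subseteq> Dinf" by (auto simp: K_def DinfD)
  have "A ` K \<subseteq> span W" using neg by (auto simp: K_def)
  from bounded_on_finite_dimensional[OF AK this \<open>finite W\<close>, of A]
  obtain C1 where C1: "C1 \<ge> 0" "\<And>x. x \<in> A ` K \<Longrightarrow> norm (A x) \<le> C1 * norm x"
    using AKD by (metis DinfD(1) generator_linear(2,4) subsetD)
  obtain C2 where C2: "C2 > 0" "\<And>h. norm (l h) \<le> norm h * C2"
    using bounded_linear.pos_bounded[OF l] by blast
  let ?L = "\<lambda>h. (l h, l (A h))"
  \<comment> \<open>Index 2, because the lift h' below needs control of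
    \<open>A (A h')\<close>.\<close>
  let ?B = "{g \<in> Dinf. graph_seminorm A 2 g < 1}"
  have "openin euclidean (?L ` ?B)"
    by (rule open_map[unfolded open_map_def, rule_format, OF openin_graph_ball])
  then have "open (?L ` ?B)" by (simp only: open_openin)
  moreover have "0 \<in> ?L ` ?B"
    using subspace_0[OF subspace_Dinf] generator_linear(4)[OF zero_in_dom zero_in_dom, of 0]
    by (intro image_eqI[of _ _ 0]) (simp_all add: linear_0[OF lin] graph_seminorm_zero zero_prod_def)
  ultimately obtain r where r: "r > 0" "ball 0 r \<subseteq> ?L ` ?B"
    using openE by blast
  \<comment> \<open>With N = norm h + norm (A h), the pair (l h, l (A h)) has norm at most C2 N,
    which is less than r times b N. So it lifts to h' with seminorm at most b N, and h - h' lies in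
    K. Bounding A (A (h - h')) by C1 times norm (A (h - h')) and adding A (A h') gives the constant
    \<open>C\<close>.\<close>
  define b where "b = 2 / r * C2"
  define C where "C = C1 + (C1 + 1) * b"
  have "norm (A (A h)) \<le> C * (norm h + norm (A h))" if h: "h \<in> Dinf" for h
  proof -
    define N where "N = norm h + norm (A h)"
    show ?thesis
    proof (cases "h = 0")
      case True
      then show ?thesis
        using generator_linear(4)[OF zero_in_dom zero_in_dom, of 0] by simp
    next
      case False
      define a where "a = b * N"
      have N: "N > 0" using False by (simp add: N_def add_pos_nonneg)
      have a: "a > 0" using r C2 N by (simp add: a_def b_def)
      have "norm (?L h) \<le> C2 * N"
        using norm_Pair_le[of "l h" "l (A h)"] C2(2)[of h] C2(2)[of "A h"]
        by (simp add: N_def algebra_simps)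
      also have "\<dots> < a * r" using r C2 N by (simp add: a_def b_def)
      finally have "norm (?L h) / a < r" using a by (simp only: pos_divide_less_eq mult.commute)
      then have "norm ((1 / a) *\<^sub>R ?L h) < r" using a by (simp only: norm_scaleR) simp
      then have "(1 / a) *\<^sub>R ?L h \<in> ?L ` ?B" using r(2) by (auto simp: dist_norm)
      then obtain g where g: "g \<in> Dinf" "graph_seminorm A 2 g < 1" "(1 / a) *\<^sub>R ?L h = ?L g"
        by blast
      define h' where "h' = a *\<^sub>R g"
      have h': "h' \<in> Dinf" "l h' = l h" "l (A h') = l (A h)"
        using g a subspace_scale[OF subspace_Dinf g(1), of a] generator_linear(4)[of g g a]
        by (auto simp: h'_def DinfD linear_scale[OF lin] dest!: sym[of _ "l g"] sym[of _ "l (A g)"])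
      have k: "h - h' \<in> K"
        using h h' by (simp add: K_def subspace_diff[OF subspace_Dinf] linear_diff[OF lin] generator_Dinf_diff)
      have "graph_seminorm A 2 h' \<le> a"
        using g a by (simp add: h'_def graph_seminorm_Dinf)
      moreover have "graph_seminorm A 2 h' = norm h' + norm (A h') + norm (A (A h'))"
        by (simp add: graph_seminorm_def numeral_2_eq_2)
      ultimately have le: "norm (A h') \<le> a" "norm (A (A h')) \<le> a"
        using norm_ge_zero[of h'] norm_ge_zero[of "A h'"] norm_ge_zero[of "A (A h')"] by linarith+
      have "A (A (h - h')) = A (A h) - A (A h')" "A (h - h') = A h - A h'"
        using h h' by (simp_all add: generator_Dinf_diff DinfD)
      moreover have "norm (A (A (h - h'))) \<le> C1 * norm (A (h - h'))"
        using k by (intro C1) auto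
      ultimately have "norm (A (A h) - A (A h')) \<le> C1 * norm (A h - A h')" by simp
      also have "norm (A h - A h') \<le> N + a"
        using le norm_triangle_ineq4[of "A h" "A h'"] norm_ge_zero[of h] unfolding N_def by linarith
      then have "C1 * norm (A h - A h') \<le> C1 * (N + a)" using C1(1) by (rule mult_left_mono)
      finally have "norm (A (A h)) \<le> C1 * (N + a) + a"
        using norm_triangle_ineq2[of "A (A h)" "A (A h')"] le by linarith
      also have "\<dots> = C * N" by (simp add: C_def a_def algebra_simps)
      finally show ?thesis by (simp add: N_def)
    qed
  qed
  from bounded_generator_imp_dom_UNIV[OF this] unbounded show False by blast
qed

subsection \<open>Brackets with the drift\<close>

lemma smooth_curve_DA0infD:
  assumes "smooth_curve (DA0inf T H0) c"
  shows "\<exists>D. D 0 = c \<and> (\<forall>n t. D n t \<in> Dinf \<and>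
    limitin (DAinf T) (\<lambda>s. (D n (t + s) - D n t) /\<^sub>R s) (D (Suc n) t) (at 0) \<and>
    (D n has_vector_derivative D (Suc n) t) (at t))"
proof -
  obtain D where D: "D 0 = c" "\<And>n t. D n t \<in> topspace (DA0inf T H0)"
    "\<And>n t. limitin (DA0inf T H0) (\<lambda>s. (D n (t + s) - D n t) /\<^sub>R s) (D (Suc n) t) (at 0)"
    using assms unfolding smooth_curve_def by auto
  note lim = limitin_DA0inf_imp[OF D(3)]
  show ?thesis
    using D(1,2) lim limitin_DAinf_imp_tendsto[OF lim] topspace_DA0inf_subset
    by (intro exI[of _ D]) (auto simp: has_vector_derivative_iff_quotient)
qed

section \<open>Derivatives of smooth maps into the domain of A_0\<close>

context
  fixes f :: "'b::real_normed_vector \<Rightarrow> 'h"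
  assumes f: "smooth_map euclidean (DA0inf T H0) f"
begin

text \<open>Scalarisation: the additivity result concerns real-valued functions.\<close>

lemma smooth_inner: "smooth_curve euclidean \<gamma> \<Longrightarrow> smooth_curve euclidean ((\<lambda>y. inner (f y) e) \<circ> \<gamma>)"
proof -
  assume "smooth_curve euclidean \<gamma>"
  then have "smooth_curve (DA0inf T H0) (f \<circ> \<gamma>)" using f by (simp add: smooth_map_def)
  from smooth_curve_DA0infD[OF this]
  obtain D where D: "D 0 = f \<circ> \<gamma>" "\<And>n t. (D n has_vector_derivative D (Suc n) t) (at t)"
    by auto
  show ?thesis unfolding smooth_curve_euclidean_iff
    by (intro exI[of _ "\<lambda>n t. inner (D n t) e"])
      (auto simp: D(1) fun_eq_iff intro!: bounded_linear.has_vector_derivative[OF bounded_linear_inner_left D(2)])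
qed

lemma smooth_map_along_line:
  shows "f y \<in> Dinf"
    and "limitin (DAinf T) (\<lambda>s. (f (y + s *\<^sub>R v) - f y) /\<^sub>R s) (dir_vec_deriv f y v) (at 0)"
    and "((\<lambda>t. f (y + t *\<^sub>R v)) has_vector_derivative dir_vec_deriv f (y + t *\<^sub>R v) v) (at t)"
    and "isCont (\<lambda>t. dir_vec_deriv f (y + t *\<^sub>R v) v) t"
proof -
  have "smooth_curve (DA0inf T H0) (f \<circ> (\<lambda>t. y + t *\<^sub>R v))"
    using f smooth_curve_line[of y v] unfolding smooth_map_def by blast
  from smooth_curve_DA0infD[OF this] obtain D where D: "D 0 = f \<circ> (\<lambda>t. y + t *\<^sub>R v)" "\<And>n t. D n t \<in> Dinf"
    "\<And>n t. limitin (DAinf T) (\<lambda>s. (D n (t + s) - D n t) /\<^sub>R s) (D (Suc n) t) (at 0)"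
    "\<And>n t. (D n has_vector_derivative D (Suc n) t) (at t)"
    by auto
  have D0: "D 0 t = f (y + t *\<^sub>R v)" for t by (simp add: D(1))
  have D1: "D 1 t = dir_vec_deriv f (y + t *\<^sub>R v) v" for t
  proof -
    have "((\<lambda>s. (D 0 (t + s) - D 0 t) /\<^sub>R s) \<longlongrightarrow> D 1 t) (at 0)"
      using D(4)[of 0 t] by (simp add: has_vector_derivative_iff_quotient)
    then have "((\<lambda>s. f (y + t *\<^sub>R v + s *\<^sub>R v)) has_vector_derivative D 1 t) (at 0)"
      by (simp add: has_vector_derivative_iff_quotient D0 scaleR_add_left add.assoc)
    then show ?thesis unfolding dir_vec_deriv_def by (rule vector_derivative_at[symmetric])
  qed
  show "f y \<in> Dinf" using D(2)[of 0 0] by (simp add: D0)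
  show "limitin (DAinf T) (\<lambda>s. (f (y + s *\<^sub>R v) - f y) /\<^sub>R s) (dir_vec_deriv f y v) (at 0)"
    using D(3)[of 0 0] by (simp add: D0 D1[of 0, simplified])
  show "((\<lambda>t. f (y + t *\<^sub>R v)) has_vector_derivative dir_vec_deriv f (y + t *\<^sub>R v) v) (at t)"
    using D(4)[of 0 t] by (simp add: D0 [abs_def] D1[symmetric])
  have "isCont (D 1) t" using D(4) has_vector_derivative_continuous by blast
  moreover have "D 1 = (\<lambda>t. dir_vec_deriv f (y + t *\<^sub>R v) v)" by (rule ext) (rule D1)
  ultimately show "isCont (\<lambda>t. dir_vec_deriv f (y + t *\<^sub>R v) v) t" by (simp only:)
qed

lemma dir_vec_deriv_tendsto:
  "((\<lambda>s. (f (y + s *\<^sub>R v) - f y) /\<^sub>R s) \<longlongrightarrow> dir_vec_deriv f y v) (at 0)"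
  using limitin_DAinf_imp_tendsto[OF smooth_map_along_line(2)] .

lemma dir_vec_deriv_scaleR: "dir_vec_deriv f y (c *\<^sub>R v) = c *\<^sub>R dir_vec_deriv f y v"
proof (cases "c = 0")
  case True
  have "((\<lambda>t. f y) has_vector_derivative 0) (at (0::real))" by simp
  then show ?thesis using True by (simp add: dir_vec_deriv_def)
next
  case False
  have "filterlim (\<lambda>s. s * c) (at 0) (at (0::real))"
  proof -
    have "((\<lambda>s. s * c) \<longlongrightarrow> 0 * c) (at (0::real))" by (intro tendsto_intros)
    with False show ?thesis by (simp add: filterlim_at eventually_at_filter)
  qed
  from tendsto_scaleR[OF tendsto_const filterlim_compose[OF dir_vec_deriv_tendsto this], of c y v]
  have "((\<lambda>s. (f (y + s *\<^sub>R (c *\<^sub>R v)) - f y) /\<^sub>R s) \<longlongrightarrow> c *\<^sub>R dir_vec_deriv f y v) (at 0)"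
    using False by (simp add: mult.left_commute[of c])
  with dir_vec_deriv_tendsto show ?thesis using LIM_unique by blast
qed

lemma dir_vec_deriv_add: "dir_vec_deriv f y (v + w) = dir_vec_deriv f y v + dir_vec_deriv f y w"
proof -
  let ?d = "dir_vec_deriv f y"
  \<comment> \<open>Testing against the additivity defect itself makes its squared norm
    vanish.\<close>
  define e where "e = ?d (v + w) - (?d v + ?d w)"
  have "((\<lambda>s. (inner (f (y + s *\<^sub>R u)) e - inner (f y) e) / s) \<longlongrightarrow> inner (?d u) e) (at 0)" for u
    using tendsto_inner[OF dir_vec_deriv_tendsto[of y u] tendsto_const[of e]]
    by (simp add: inner_diff_left divide_inverse mult.commute)
  from additive_directional_derivative[of "\<lambda>y. inner (f y) e", OF smooth_inner this this this]
  have "inner e e = 0" by (simp add: e_def inner_diff_left inner_add_left)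
  then show ?thesis by (simp add: e_def)
qed

text \<open>The definite description resolves because limits in D(A^infinity) are norm limits, hence
  unique.\<close>

lemma dir_deriv_compose_linear:
  assumes "linear l"
  shows "dir_deriv (DAinf T) (\<lambda>h. f (l h)) h v = dir_vec_deriv f (l h) (l v)"
proof -
  have eq: "(\<lambda>s. (f (l (h + s *\<^sub>R v)) - f (l h)) /\<^sub>R s) = (\<lambda>s. (f (l h + s *\<^sub>R l v) - f (l h)) /\<^sub>R s)"
    by (simp add: linear_add[OF assms] linear_scale[OF assms])
  show ?thesis unfolding dir_deriv_def eq
  proof (rule the_equality)
    show "limitin (DAinf T) (\<lambda>s. (f (l h + s *\<^sub>R l v) - f (l h)) /\<^sub>R s) (dir_vec_deriv f (l h) (l v)) (at 0)"
      by (rule smooth_map_along_line(2))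
    fix w assume "limitin (DAinf T) (\<lambda>s. (f (l h + s *\<^sub>R l v) - f (l h)) /\<^sub>R s) w (at 0)"
    from LIM_unique[OF limitin_DAinf_imp_tendsto[OF this] dir_vec_deriv_tendsto]
    show "w = dir_vec_deriv f (l h) (l v)" .
  qed
qed

end

context
  fixes d :: nat and l :: "'h \<Rightarrow> 'b::real_normed_vector" and \<phi> :: "nat \<Rightarrow> 'b \<Rightarrow> 'h"
  assumes l: "bounded_linear l"
    and smooth: "\<And>j. j \<in> {1..d} \<Longrightarrow> smooth_map euclidean (DA0inf T H0) (\<phi> j)"
    and open_map: "open_map (DAinf T) euclidean (\<lambda>h. (l h, l (A h)))"
    and indep: "\<And>y. independent_family (\<lambda>j. \<phi> j y) {1..d}"
    and unbounded: "Dom \<noteq> UNIV"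
begin

abbreviation "\<mu> \<equiv> drift T S d (vol \<phi> l)"
abbreviation "fibre y \<equiv> span ((\<lambda>j. \<phi> j y) ` {1..d})"
abbreviation "bracket i \<equiv> lie_bracket (DAinf T) \<mu> (vol \<phi> l i)"
abbreviation "D\<phi> i \<equiv> dir_vec_deriv (\<phi> i)"

text \<open>The part of the drift that factors through l, so that only A h separates points with the
  same l h.\<close>

definition drift_part :: "'b \<Rightarrow> 'h" where
  "drift_part y = (\<Sum>j=1..d. S (\<phi> j y) (\<phi> j y)) - (1/2) *\<^sub>R (\<Sum>j=1..d. D\<phi> j y (l (\<phi> j y)))"

lemma lin_l: "linear l"
  by (rule bounded_linear.linear[OF l])

lemma dir_deriv_vol: "i \<in> {1..d} \<Longrightarrow> dir_deriv (DAinf T) (vol \<phi> l i) h v = D\<phi> i (l h) (l v)"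
  using dir_deriv_compose_linear[OF smooth lin_l] by (simp add: vol_def [abs_def])

lemma drift_eq: "\<mu> h = A h + drift_part (l h)"
  by (simp add: drift_def drift_part_def dir_deriv_vol) (simp add: vol_def)

text \<open>
  Whether or not the derivative of the drift exists, the definite description in \<open>dir_deriv\<close> depends
  on the base point \<open>h\<close> through \<open>l h\<close> only, because \<open>A\<close> contributes the same term \<open>s *\<^sub>R A v\<close> at every base point.
\<close>

lemma dir_deriv_drift_cong:
  assumes "h \<in> Dinf" "h' \<in> Dinf" "v \<in> Dinf" "l h = l h'"
  shows "dir_deriv (DAinf T) \<mu> h v = dir_deriv (DAinf T) \<mu> h' v"
proof -
  have "\<mu> (h + s *\<^sub>R v) - \<mu> h = s *\<^sub>R A v + (drift_part (l h + s *\<^sub>R l v) - drift_part (l h))"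
    if "h \<in> Dinf" for s h
    using that assms(3) generator_linear(2)[of h "s *\<^sub>R v"] generator_linear(3,4)[of v v s]
    by (simp add: drift_eq DinfD linear_add[OF lin_l] linear_scale[OF lin_l])
  then show ?thesis unfolding dir_deriv_def using assms by simp
qed

text \<open>The field \<open>vol \<phi> l i\<close> has the same value at both points, so the terms
  with the derivative of the drift cancel. In the other terms linearity of the derivative of \<phi>
  leaves the difference of l (\<mu> h') and l (\<mu> h), where \<open>drift_part\<close>
  cancels.\<close>

lemma bracket_diff:
  assumes "h \<in> Dinf" "h' \<in> Dinf" "l h = l h'" "i \<in> {1..d}"
  shows "bracket i h - bracket i h' = D\<phi> i (l h) (l (A h') - l (A h))"
proof -
  note lin = dir_vec_deriv_add[OF smooth[OF assms(4)]] dir_vec_deriv_scaleR[OF smooth[OF assms(4)]]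
  have "dir_deriv (DAinf T) \<mu> h (vol \<phi> l i h) = dir_deriv (DAinf T) \<mu> h' (vol \<phi> l i h')"
    using dir_deriv_drift_cong[of h h' "\<phi> i (l h)"] smooth_map_along_line(1)[OF smooth] assms
    by (simp add: vol_def)
  then have "bracket i h - bracket i h' = D\<phi> i (l h) (l (\<mu> h')) - D\<phi> i (l h) (l (\<mu> h))"
    using assms by (simp add: lie_bracket_def dir_deriv_vol)
  also have "\<dots> = D\<phi> i (l h) (l (\<mu> h') + (- 1) *\<^sub>R l (\<mu> h))"
    unfolding lin by simp
  also have "l (\<mu> h') + (- 1) *\<^sub>R l (\<mu> h) = l (A h') - l (A h)"
    using assms by (simp add: drift_eq linear_add[OF lin_l])
  finally show ?thesis .
qed

section \<open>Constancy of the fibres on U\<close>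

context
  fixes U :: "'h set"
  assumes U: "openin (DAinf T) U"
    and dim_U: "\<And>h. h \<in> U \<Longrightarrow> dim (D_LA T S d (vol \<phi> l) h) = d + 1"
begin

lemma U_Dinf: "h \<in> U \<Longrightarrow> h \<in> Dinf"
  using openin_subset[OF U] by blast

lemma distribution_members:
  assumes "i \<in> {1..d}"
  shows "\<phi> i (l h) \<in> D_LA T S d (vol \<phi> l) h" "\<mu> h \<in> D_LA T S d (vol \<phi> l) h"
    "bracket i h \<in> D_LA T S d (vol \<phi> l) h"
proof -
  let ?V = "insert \<mu> (vol \<phi> l ` {1..d})"
  have b: "\<mu> \<in> iterated_brackets (DAinf T) ?V" "vol \<phi> l i \<in> iterated_brackets (DAinf T) ?V"
    using assms by (auto intro: iterated_brackets.base)
  note b' = b iterated_brackets.bracket[OF b]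
  show "\<phi> i (l h) \<in> D_LA T S d (vol \<phi> l) h" "\<mu> h \<in> D_LA T S d (vol \<phi> l) h"
    "bracket i h \<in> D_LA T S d (vol \<phi> l) h"
    unfolding D_LA_def lie_distribution_def
    using imageI[OF b'(1), of "\<lambda>F. F h"] imageI[OF b'(2), of "\<lambda>F. F h"] imageI[OF b'(3), of "\<lambda>F. F h"]
    by (auto simp: vol_def intro!: span_base)
qed

text \<open>Positive dimension makes the basis finite, since infinite sets have cardinality 0; then
  d + 1 independent members must span.\<close>

lemma distribution_subset_span:
  assumes "h \<in> U" "W \<subseteq> D_LA T S d (vol \<phi> l) h" "independent W" "card W = d + 1"
  shows "D_LA T S d (vol \<phi> l) h \<subseteq> span W"
proof -
  obtain B where B: "independent B" "D_LA T S d (vol \<phi> l) h \<subseteq> span B"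
    "card B = dim (D_LA T S d (vol \<phi> l) h)"
    using basis_exists by blast
  have "card B = d + 1" using B(3) dim_U[OF assms(1)] by simp
  moreover from this have "finite B" using card.infinite by fastforce
  ultimately show ?thesis
    using independent_card_ge_imp_span[of B _ W] B(2) assms by simp
qed

lemma eventually_in_U:
  assumes "h \<in> U" "k \<in> Dinf"
  shows "\<forall>\<^sub>F t in at 0. h + t *\<^sub>R k \<in> U"
proof -
  have "limitin (DAinf T) (\<lambda>t. h + t *\<^sub>R k) h (at 0)"
  proof (rule limitin_DAinfI)
    show "h \<in> Dinf" using assms U_Dinf by blast
    fix n and \<epsilon> :: real assume \<epsilon>: "\<epsilon> > 0"
    have "((\<lambda>t. \<bar>t\<bar> * graph_seminorm A n k) \<longlongrightarrow> \<bar>0\<bar> * graph_seminorm A n k) (at 0)"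
      by (intro tendsto_intros)
    then have "\<forall>\<^sub>F t in at 0. \<bar>t\<bar> * graph_seminorm A n k < \<epsilon>"
      using \<epsilon> by (intro order_tendstoD(2)) auto
    then show "\<forall>\<^sub>F t in at 0. h + t *\<^sub>R k \<in> Dinf \<and> graph_seminorm A n (h + t *\<^sub>R k - h) < \<epsilon>"
      by (rule eventually_mono)
        (use assms U_Dinf in \<open>simp add: graph_seminorm_Dinf subspace_add[OF subspace_Dinf] subspace_scale[OF subspace_Dinf]\<close>)
  qed
  then show ?thesis using U assms(1) by (simp add: limitin_def)
qed

lemma bracket_in_fibre:
  assumes h: "h \<in> U" and i: "i \<in> {1..d}"
  shows "bracket i h \<in> fibre (l h)"
proof (rule ccontr)
  assume not_in: "bracket i h \<notin> fibre (l h)"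
  define V where "V = (\<lambda>j. \<phi> j (l h)) ` {1..d}"
  define W where "W = insert (bracket i h) V"
  have V: "independent V" "card V = d" "finite V"
    using indep[of "l h"] by (auto simp: V_def independent_family_def card_image)
  have out: "bracket i h \<notin> span V" using not_in by (simp add: V_def)
  then have "bracket i h \<notin> V" using span_base by blast
  then have W: "independent W" "card W = d + 1" "finite W"
    unfolding W_def using V independent_insertI[OF out V(1)] by simp_all
  \<comment> \<open>\<open>W\<close> is built from vectors at h alone, so k can be chosen after it.
    The value t = 0 below also places \<mu> h in \<open>span W\<close>.\<close>
  obtain k where k: "k \<in> Dinf" "l k = 0" "l (A k) = 0" "A k \<notin> span W"
    using generator_kernel_infinite_dimensional[OF l open_map unbounded W(3)] by blast
  have \<mu>_in: "\<mu> (h + t *\<^sub>R k) \<in> span W" if t: "h + t *\<^sub>R k \<in> U" for t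
  proof -
    have lh: "l (h + t *\<^sub>R k) = l h" by (simp add: linear_add[OF lin_l] linear_scale[OF lin_l] k)
    have Ah: "A (h + t *\<^sub>R k) = A h + t *\<^sub>R A k"
      using h k U_Dinf generator_linear(2)[of h "t *\<^sub>R k"] generator_linear(3,4)[of k k t] by (simp add: DinfD)
    have "D\<phi> i (l h) 0 = 0" using dir_vec_deriv_scaleR[OF smooth[OF i], of "l h" 0 0] by simp
    then have bracket_eq: "bracket i (h + t *\<^sub>R k) = bracket i h"
      using bracket_diff[of "h + t *\<^sub>R k" h i] t h U_Dinf lh i k
      by (simp add: Ah linear_add[OF lin_l] linear_scale[OF lin_l])
    have "W \<subseteq> D_LA T S d (vol \<phi> l) (h + t *\<^sub>R k)"
      unfolding W_def V_def lh[symmetric] bracket_eq[symmetric]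
      using distribution_members(1) distribution_members(3)[OF i] by blast
    from distribution_subset_span[OF t this W(1,2)] show ?thesis
      using distribution_members(2)[OF i] by blast
  qed
  have "\<forall>\<^sub>F t in at (0::real). h + t *\<^sub>R k \<in> U \<and> t \<noteq> 0"
    using eventually_in_U[OF h k(1)] by (auto simp: eventually_at_filter)
  then obtain t where t: "h + t *\<^sub>R k \<in> U" "t \<noteq> 0"
    using eventually_happens' at_neq_bot by blast
  have "\<mu> (h + t *\<^sub>R k) - \<mu> h = t *\<^sub>R A k"
    using h k U_Dinf generator_linear(2)[of h "t *\<^sub>R k"] generator_linear(3,4)[of k k t]
    by (simp add: drift_eq DinfD linear_add[OF lin_l] linear_scale[OF lin_l])
  moreover have "\<mu> (h + t *\<^sub>R k) - \<mu> h \<in> span W"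
    using \<mu>_in[OF t(1)] \<mu>_in[of 0] h by (intro span_diff) auto
  ultimately have "A k \<in> span W" using t(2) span_scale[of "t *\<^sub>R A k" W "1 / t"] by simp
  with k show False by blast
qed

lemma open_image: "open ((\<lambda>h. (l h, l (A h))) ` U)"
  using open_map[unfolded open_map_def, rule_format, OF U] by (simp only: open_openin)

text \<open>Only small multiples s v are reachable inside the open image, so homogeneity is used to
  divide by s. The second point has the same y, hence both brackets lie in one fibre.\<close>

lemma derivative_in_fibre:
  assumes h: "h \<in> U" and i: "i \<in> {1..d}"
  shows "D\<phi> i (l h) v \<in> fibre (l h)"
proof -
  let ?z = "(l h, l (A h))"
  have lim: "((\<lambda>s. ?z + s *\<^sub>R (0, v)) \<longlongrightarrow> ?z + 0 *\<^sub>R (0, v)) (at (0::real))"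
    by (intro tendsto_intros)
  have "\<forall>\<^sub>F s in at (0::real). ?z + s *\<^sub>R (0, v) \<in> (\<lambda>h. (l h, l (A h))) ` U"
    by (rule topological_tendstoD[OF lim open_image]) (use h in simp)
  then have "\<forall>\<^sub>F s in at (0::real). ?z + s *\<^sub>R (0, v) \<in> (\<lambda>h. (l h, l (A h))) ` U \<and> s \<noteq> 0"
    by (auto simp: eventually_at_filter)
  then obtain s where s: "?z + s *\<^sub>R (0, v) \<in> (\<lambda>h. (l h, l (A h))) ` U" "s \<noteq> 0"
    using eventually_happens' at_neq_bot by blast
  then obtain h' where h': "h' \<in> U" "l h' = l h" "l (A h') = l (A h) + s *\<^sub>R v" by auto
  have "bracket i h - bracket i h' = s *\<^sub>R D\<phi> i (l h) v"
    using bracket_diff[of h h' i] h h' U_Dinf i by (simp add: dir_vec_deriv_scaleR[OF smooth])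
  moreover have "bracket i h - bracket i h' \<in> fibre (l h)"
    using bracket_in_fibre[OF h i] bracket_in_fibre[OF h'(1) i] h'(2) by (intro span_diff) auto
  ultimately have "s *\<^sub>R D\<phi> i (l h) v \<in> fibre (l h)" by simp
  from span_scale[OF this, of "1 / s"] show ?thesis using s(2) by simp
qed

text \<open>The slice at z = l (A h) of a ball in the open image shows that every y near l h is
  attained on U, so the frame is tangent to its own span on a whole ball, which contains the
  segments from its centre.\<close>

lemma fibre_locally_constant:
  assumes h: "h \<in> U"
  shows "\<exists>r>0. \<forall>y\<in>ball (l h) r. fibre y = fibre (l h)"
proof -
  obtain r where r: "r > 0" "ball (l h, l (A h)) r \<subseteq> (\<lambda>h. (l h, l (A h))) ` U"
    using open_image h by (meson imageI openE)
  have tangent: "D\<phi> i y v \<in> fibre y" if y: "y \<in> ball (l h) r" and i: "i \<in> {1..d}" for y i v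
  proof -
    have "(y, l (A h)) \<in> ball (l h, l (A h)) r" using y by (simp add: dist_Pair_Pair)
    then obtain h' where "h' \<in> U" "l h' = y" using r(2) by auto
    with derivative_in_fibre[of h' i v] i show ?thesis by blast
  qed
  have "fibre y = fibre (l h)" if y: "y \<in> ball (l h) r" for y
  proof -
    define v where "v = y - l h"
    \<comment> \<open>An open set of parameters containing [0, 1], so that the moving-frame result
      also applies at the endpoints.\<close>
    define J where "J = (\<lambda>t. l h + t *\<^sub>R v) -` ball (l h) r"
    have "open J" unfolding J_def by (intro open_vimage continuous_intros) auto
    have J: "t \<in> J" if "t \<in> {0..1}" for t
    proof -
      have "\<bar>t\<bar> * norm v \<le> 1 * norm v" using that by (intro mult_right_mono) auto
      also have "\<dots> < r" using y by (simp add: v_def dist_norm norm_minus_commute)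
      finally show ?thesis by (simp add: J_def dist_norm)
    qed
    have loc: "\<forall>\<^sub>F s in at t. fibre (l h + s *\<^sub>R v) = fibre (l h + t *\<^sub>R v)" if t: "t \<in> J" for t
      by (rule span_moving_frame_locally_constant[where J = J
            and g' = "\<lambda>i t. D\<phi> i (l h + t *\<^sub>R v) v"])
        (use \<open>open J\<close> t tangent indep smooth_map_along_line(3,4)[OF smooth] in \<open>auto simp: J_def\<close>)
    have "fibre (l h + 0 *\<^sub>R v) = fibre (l h + 1 *\<^sub>R v)"
    proof (rule connected_local_const[where A = "{0..1::real}" and f = "\<lambda>t. fibre (l h + t *\<^sub>R v)"])
      show "\<forall>a\<in>{0..1}. \<forall>\<^sub>F b in at a within {0..1}. fibre (l h + a *\<^sub>R v) = fibre (l h + b *\<^sub>R v)"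
      proof
        fix a :: real assume "a \<in> {0..1}"
        from loc[OF J[OF this]] have "\<forall>\<^sub>F s in at a within {0..1}. fibre (l h + s *\<^sub>R v) = fibre (l h + a *\<^sub>R v)"
          using at_le[of "{0..1}" UNIV a] filter_leD by blast
        then show "\<forall>\<^sub>F b in at a within {0..1}. fibre (l h + a *\<^sub>R v) = fibre (l h + b *\<^sub>R v)"
          by (rule eventually_mono) simp
      qed
    qed auto
    then show ?thesis by (simp add: v_def)
  qed
  with r(1) show ?thesis by blast
qed

text \<open>The seminorm of index 0 is the norm of H, so l is continuous on D(A^infinity).\<close>

lemma openin_preimage_ball: "openin (DAinf T) {h' \<in> U. dist (l h) (l h') < r}"
proof -
  obtain C where C: "C > 0" "\<And>h. norm (l h) \<le> norm h * C"
    using bounded_linear.pos_bounded[OF l] by blast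
  have "\<exists>V. openin (DAinf T) V \<and> h' \<in> V \<and> V \<subseteq> {h' \<in> U. dist (l h) (l h') < r}"
    if h': "h' \<in> U" "dist (l h) (l h') < r" for h'
  proof -
    define \<rho> where "\<rho> = (r - dist (l h) (l h')) / C"
    have \<rho>: "\<rho> > 0" using h' C by (simp add: \<rho>_def)
    define V where "V = U \<inter> {g \<in> Dinf. graph_seminorm A 0 (g - h') < \<rho>}"
    have "openin (DAinf T) V"
      unfolding V_def using U U_Dinf[OF h'(1)] openin_seminorm_ball[of h' Dinf "graph_seminorm A" 0 \<rho>]
      by (intro openin_Int) (simp_all add: DAinf_def smooth_domain_def)
    moreover have "h' \<in> V" using h' U_Dinf \<rho> by (simp add: V_def graph_seminorm_zero)
    moreover have "dist (l h) (l g) < r" if "g \<in> V" for g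
    proof -
      have "dist (l h') (l g) = norm (l (g - h'))"
        by (simp add: linear_diff[OF lin_l] dist_norm norm_minus_commute)
      also have "\<dots> \<le> norm (g - h') * C" by (rule C)
      also have "\<dots> < \<rho> * C"
        using that norm_le_graph_seminorm[of "g - h'" 0] C(1) by (intro mult_strict_right_mono) (auto simp: V_def)
      also have "\<dots> = r - dist (l h) (l h')" using C(1) by (simp add: \<rho>_def)
      finally show ?thesis using dist_triangle[of "l h" "l g" "l h'"] by simp
    qed
    ultimately show ?thesis by (intro exI[of _ V]) (auto simp: V_def)
  qed
  then show ?thesis by (subst openin_subopen) blast
qed

lemma fibre_constant:
  assumes conn: "connectedin (DAinf T) U" and h: "h0 \<in> U" "h1 \<in> U"
  shows "fibre (l h1) = fibre (l h0)"
proof (rule ccontr)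
  assume neq: "fibre (l h1) \<noteq> fibre (l h0)"
  \<comment> \<open>For an arbitrary predicate P, so that the points with the fibre of h0 and those
    with another fibre both form open sets.\<close>
  have op: "openin (DAinf T) {h \<in> U. P (fibre (l h))}" for P
  proof (subst openin_subopen, intro ballI)
    fix h assume h: "h \<in> {h \<in> U. P (fibre (l h))}"
    then obtain r where r: "r > 0" "\<And>y. y \<in> ball (l h) r \<Longrightarrow> fibre y = fibre (l h)"
      using fibre_locally_constant by blast
    have "h' \<in> {h \<in> U. P (fibre (l h))}" if h': "h' \<in> U" "dist (l h) (l h') < r" for h'
    proof -
      have "fibre (l h') = fibre (l h)" by (rule r(2)) (use h' in simp)
      then show ?thesis using h h'(1) by (simp only: mem_Collect_eq)
    qed
    moreover have "h \<in> {h' \<in> U. dist (l h) (l h') < r}" using h r(1) by simp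
    ultimately show "\<exists>V. openin (DAinf T) V \<and> h \<in> V \<and> V \<subseteq> {h \<in> U. P (fibre (l h))}"
      using openin_preimage_ball[of h r] by blast
  qed
  define E1 where "E1 = {h \<in> U. fibre (l h) = fibre (l h0)}"
  define E2 where "E2 = {h \<in> U. fibre (l h) \<noteq> fibre (l h0)}"
  have "openin (DAinf T) E1" "openin (DAinf T) E2" unfolding E1_def E2_def by (rule op)+
  moreover have "U \<subseteq> E1 \<union> E2" "E1 \<inter> E2 \<inter> U = {}" by (auto simp: E1_def E2_def)
  moreover have "h0 \<in> E1 \<inter> U" "h1 \<in> E2 \<inter> U" using h neq by (simp_all add: E1_def E2_def)
  ultimately show False using conn unfolding connectedin by blast
qed

end

end

end

theorem proposition1:
  fixes ev :: "'h::{real_inner, complete_space} \<Rightarrow> real \<Rightarrow> real"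
    and T :: "real \<Rightarrow> 'h \<Rightarrow> 'h"
    and H0 :: "'h set"
    and S :: "'h \<Rightarrow> 'h \<Rightarrow> 'h"
    and d k\<^sub>D :: nat
    and l :: "'h \<Rightarrow> 'b::banach"
    and \<phi> :: "nat \<Rightarrow> 'b \<Rightarrow> 'h"
    and \<sigma> :: "nat \<Rightarrow> 'h \<Rightarrow> 'h"
    and U :: "'h set"
  defines "\<sigma> \<equiv> vol \<phi> l"
  assumes "forward_curve_space ev T H0 S"
    and "d \<ge> 1"
    and "bounded_linear l"
    and "\<And>j. j \<in> {1..d} \<Longrightarrow> smooth_map euclidean (DA0inf T H0) (\<phi> j)"
    and "open_map (DAinf T) euclidean (\<lambda>h. (l h, l (generator T h)))"
    and "\<And>y. independent_family (\<lambda>j. \<phi> j y) {1..d}"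
    and "generator_dom T \<noteq> UNIV"
    and "openin (DAinf T) U"
    and "connectedin (DAinf T) U"
    and "\<And>h. h \<in> U \<Longrightarrow> dim (D_LA T S d \<sigma> h) = k\<^sub>D"
    and "k\<^sub>D = d + 1"
  shows "\<exists>\<Lambda> :: nat \<Rightarrow> 'h.
    (\<forall>i\<in>{1..d}. \<Lambda> i \<in> topspace (DAinf T)) \<and>
    independent_family \<Lambda> {1..d} \<and>
    (\<forall>h\<in>U. \<forall>j\<in>{1..d}. \<sigma> j h \<in> span (\<Lambda> ` {1..d}))"
proof -
  interpret forward_curve_space ev T H0 S by fact
  \<comment> \<open>For empty U any base point serves: the frame is independent at every y and the
    containment is vacuous.\<close>
  define y where "y = (if U = {} then 0 else l (SOME h. h \<in> U))"
  have dim: "dim (D_LA T S d (vol \<phi> l) h) = d + 1" if "h \<in> U" for h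
    using assms(11)[OF that] assms(12) by (simp add: \<sigma>_def)
  have "\<sigma> j h \<in> span ((\<lambda>i. \<phi> i y) ` {1..d})" if h: "h \<in> U" and j: "j \<in> {1..d}" for h j
  proof -
    have "(SOME h. h \<in> U) \<in> U" using h by (rule someI)
    from fibre_constant[OF assms(4-8) assms(9) dim assms(10) this h]
    have "span ((\<lambda>i. \<phi> i (l h)) ` {1..d}) = span ((\<lambda>i. \<phi> i y) ` {1..d})"
      using h by (auto simp: y_def)
    moreover have "\<sigma> j h \<in> span ((\<lambda>i. \<phi> i (l h)) ` {1..d})"
      using j by (auto simp: \<sigma>_def vol_def intro: span_base)
    ultimately show ?thesis by simp
  qed
  moreover have "\<forall>i\<in>{1..d}. \<phi> i y \<in> topspace (DAinf T)"
    using smooth_map_along_line(1)[OF assms(5)] by blast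
  ultimately show ?thesis
    using assms(7)[of y] by (intro exI[of _ "\<lambda>i. \<phi> i y"] conjI) blast+
qed

end
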